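(* Let $H\sim\mathcal{N}(0,\Sigma)$ be a random $M\times N$ channel matrix whose covariance $\Sigma$ is separable, and suppose $\mathcal{C}_\Sigma\neq\mathbb{C}\cdot\mathbf{1}_N$. Let $\{P_j\}_{j=1}^c$ be any resolution of identity consisting of minimal projections in $\mathcal{C}_\Sigma^t$, and let $U$ be an $N\times N$ unitary matrix whose columns form an orthonormal basis of $\mathbb{C}^N$ consisting of an orthonormal basis of $\mathrm{range}(P_1)$, followed by one of $\mathrm{range}(P_2)$, ..., followed by one of $\mathrm{range}(P_c)$. Then there exists a capacity-achieving covariance matrix $Q$ (i.e. a maximizer of $C(Q)$ over $\{Q\ge0,\ \mathrm{tr}(Q)\le p\}$) of the form $Q=U\,\mathrm{diag}(Q_1,\dots,Q_c)\,U^H$, where $Q_j$ is a square block of size $\mathrm{tr}(P_j)$; equivalently, $QP_j=P_jQ$ for all $j$, so each $Q$ maps $\mathrm{range}(P_j)$ into itself.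
   Context: Fix integers $M,N\ge1$, noise variance $\sigma_n^2>0$ and power $p>0$. We identify $\mathbb{M}(M,\mathbb{C})\otimes\mathbb{M}(N,\mathbb{C})$ with $\mathbb{M}(MN,\mathbb{C})$ via $(A\otimes B)_{(i,j),(l,m)}=A_{il}B_{jm}$. $H\sim\mathcal{N}(0,\Sigma)$ means: $H$ is a random $M\times N$ complex matrix whose entries are jointly zero-mean circularly symmetric complex Gaussian (so $\mathcal{E}(H_{ij}H_{lm})=0$ for all indices), with covariance $\Sigma\in\mathbb{M}(M,\mathbb{C})\otimes\mathbb{M}(N,\mathbb{C})$ given by $\Sigma_{(i,j),(l,m)}=\mathcal{E}(H_{ij}\overline{H_{lm}})$. For positive semidefinite $Q\in\mathbb{M}(N,\mathbb{C})$ set $C(Q):=\mathcal{E}\big(\log\det(\mathbf{1}_M+\sigma_n^{-2}HQH^H)\big)$. A positive semidefinite $\Sigma$ is separable if $\Sigma=\sum_{i=1}^n\tilde R_i\otimes\tilde T_i$ with all $\tilde R_i,\tilde T_i$ positive semidefinite. The right commutant is $\mathcal{C}_\Sigma:=\{A\in\mathbb{M}(N,\mathbb{C}) : (\mathbf{1}_M\otimes A)\Sigma=\Sigma(\mathbf{1}_M\otimes A)\}$ (a unital $*$-algebra) and $\mathcal{C}_\Sigma^t:=\{A^t : A\in\mathcal{C}_\Sigma\}$. A projection means an orthogonal projection; a nonzero projection $P$ in a $*$-algebra $\mathcal{A}$ is minimal if every projection $Q\in\mathcal{A}$ with $Q\le P$ equals $0$ or $P$. A resolution of identity in $\mathcal{A}$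 is a family of mutually orthogonal projections in $\mathcal{A}$ summing to $\mathbf{1}_N$. *)

theory Defs
  imports "HOL-Probability.Probability" "Jordan_Normal_Form.Determinant"
begin

definition mtrace :: "complex mat \<Rightarrow> complex" where
  "mtrace A = (\<Sum>i<dim_row A. A $$ (i,i))"

definition adj :: "complex mat \<Rightarrow> complex mat" where
  "adj A = mat (dim_col A) (dim_row A) (\<lambda>(i,j). cnj (A $$ (j,i)))"

(* Kronecker product, (A \<otimes> B)_{(i,j),(l,m)} = A_il B_jm with (i,j) \<mapsto> i * dim_row B + j *)
definition kron :: "complex mat \<Rightarrow> complex mat \<Rightarrow> complex mat" where
  "kron A B = mat (dim_row A * dim_row B) (dim_col A * dim_col B)
     (\<lambda>(r,s). A $$ (r div dim_row B, s div dim_col B) * B $$ (r mod dim_row B, s mod dim_col B))"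

definition psd :: "nat \<Rightarrow> complex mat \<Rightarrow> bool" where
  "psd n A \<longleftrightarrow> A \<in> carrier_mat n n \<and>
     (\<forall>v :: nat \<Rightarrow> complex. let q = (\<Sum>i<n. \<Sum>j<n. cnj (v i) * A $$ (i,j) * v j)
        in Im q = 0 \<and> Re q \<ge> 0)"

definition separable :: "nat \<Rightarrow> nat \<Rightarrow> complex mat \<Rightarrow> bool" where
  "separable M N \<Sigma> \<longleftrightarrow> \<Sigma> \<in> carrier_mat (M*N) (M*N) \<and>
     (\<exists>(n::nat) R T. (\<forall>i<n. psd M (R i) \<and> psd N (T i)) \<and>
        (\<forall>r<M*N. \<forall>s<M*N. \<Sigma> $$ (r,s) = (\<Sum>i<n. kron (R i) (T i) $$ (r,s))))"

definition right_commutant :: "nat \<Rightarrow> nat \<Rightarrow> complex mat \<Rightarrow> complex mat set" where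
  "right_commutant M N \<Sigma> = {A \<in> carrier_mat N N.
      kron (1\<^sub>m M) A * \<Sigma> = \<Sigma> * kron (1\<^sub>m M) A}"

definition is_proj :: "nat \<Rightarrow> complex mat \<Rightarrow> bool" where
  "is_proj n P \<longleftrightarrow> P \<in> carrier_mat n n \<and> P * P = P \<and> adj P = P"

definition minimal_proj :: "complex mat set \<Rightarrow> nat \<Rightarrow> complex mat \<Rightarrow> bool" where
  "minimal_proj \<A> n P \<longleftrightarrow> P \<in> \<A> \<and> is_proj n P \<and> P \<noteq> 0\<^sub>m n n \<and>
     (\<forall>Q\<in>\<A>. is_proj n Q \<and> psd n (P - Q) \<longrightarrow> Q = 0\<^sub>m n n \<or> Q = P)"

definition msum :: "nat \<Rightarrow> (nat \<Rightarrow> complex mat) \<Rightarrow> nat \<Rightarrow> complex mat" where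
  "msum n P c = mat n n (\<lambda>(r,s). \<Sum>j<c. P j $$ (r,s))"

definition Hmat :: "nat \<Rightarrow> nat \<Rightarrow> ('a \<Rightarrow> nat \<Rightarrow> nat \<Rightarrow> complex) \<Rightarrow> 'a \<Rightarrow> complex mat" where
  "Hmat M N H \<omega> = mat M N (\<lambda>(i,j). H \<omega> i j)"

(* H ~ N(0,Sigma): zero-mean circularly symmetric jointly complex Gaussian with covariance
   Sigma_{(i,j),(l,m)} = E(H_ij conj(H_lm)), characterised by its characteristic function:
   E exp(i Re(t^H vec H)) = exp(-(t^H Sigma t)/4) for all t. *)
definition cgauss :: "'a measure \<Rightarrow> nat \<Rightarrow> nat \<Rightarrow> ('a \<Rightarrow> nat \<Rightarrow> nat \<Rightarrow> complex) \<Rightarrow> complex mat \<Rightarrow> bool" where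
  "cgauss \<Omega> M N H \<Sigma> \<longleftrightarrow> prob_space \<Omega> \<and> \<Sigma> \<in> carrier_mat (M*N) (M*N) \<and>
     (\<forall>i<M. \<forall>j<N. (\<lambda>\<omega>. H \<omega> i j) \<in> borel_measurable \<Omega>) \<and>
     (\<forall>t :: nat \<Rightarrow> nat \<Rightarrow> complex.
        (LINT \<omega>|\<Omega>. cis (Re (\<Sum>i<M. \<Sum>j<N. cnj (t i j) * H \<omega> i j))) =
        complex_of_real (exp (- Re (\<Sum>i<M. \<Sum>j<N. \<Sum>l<M. \<Sum>m<N.
            cnj (t i j) * \<Sigma> $$ (i*N+j, l*N+m) * t l m) / 4)))"

definition capacity :: "'a measure \<Rightarrow> nat \<Rightarrow> nat \<Rightarrow> ('a \<Rightarrow> nat \<Rightarrow> nat \<Rightarrow> complex) \<Rightarrow> real \<Rightarrow> complex mat \<Rightarrow> real" where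
  "capacity \<Omega> M N H \<sigma>2 Q = (LINT \<omega>|\<Omega>.
     ln (Re (det (1\<^sub>m M + complex_of_real (1/\<sigma>2) \<cdot>\<^sub>m (Hmat M N H \<omega> * Q * adj (Hmat M N H \<omega>))))))"

definition in_block :: "(nat \<Rightarrow> nat) \<Rightarrow> nat \<Rightarrow> nat \<Rightarrow> bool" where
  "in_block d j k \<longleftrightarrow> (\<Sum>i<j. d i) \<le> k \<and> k < (\<Sum>i<j. d i) + d j"

end

theory Submission
  imports Defs "Jordan_Normal_Form.Char_Poly"
begin

text \<open>For each \<open>j\<close> the reflection \<open>W = 1 - 2 P\<^sub>j\<close> is a Hermitian unitary whose transpose commutes
  with \<open>\<Sigma>\<close>, so \<open>H W\<close> has the same characteristic function, hence the same law, as \<open>H\<close>, and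
  \<open>C(W Q W) = C(Q)\<close>. Since \<open>C\<close> is midpoint concave, replacing \<open>Q\<close> by \<open>(Q + W Q W) / 2\<close>
  does not decrease \<open>C\<close>, preserves the trace, makes \<open>Q\<close> commute with \<open>P\<^sub>j\<close> and keeps it commuting
  with the projections orthogonal to \<open>P\<^sub>j\<close>. Applying this for all \<open>j\<close> in turn to a maximizer, which
  exists by compactness and dominated convergence, gives the block diagonal one.\<close>

section \<open>Concavity of the logarithm of the determinant\<close>

text \<open>The law of \<open>H\<close> is given only by its characteristic function, so two facts
  have to be drawn from that function: that \<open>H\<close> and \<open>H W\<close> have the same
  law, through a multidimensional uniqueness theorem reduced to the one-dimensional theorem of Levy,
  and that the entries have second moments, through Fatou's lemma. The moments are what makes
  dominated convergence possible, since ln (1 + x) \<le> x bounds log det by a quadratic expression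
  in \<open>H\<close>, uniformly over the feasible \<open>Q\<close>. The transpose comes from
  \<open>W\<close> acting on the right of \<open>H\<close>: every N x N block S of the covariance
  turns into W^t S conj(W). For Hermitian \<open>W\<close> the conjugate is W^t again, so W^t S = S
  W^t and W^2 = 1 leave the block unchanged. Reflections are chosen because the average over the
  two-element group {1, W} is a midpoint, so midpoint concavity suffices; the price is that the
  projections are treated one at a time. Concavity itself needs neither square roots nor
  simultaneous diagonalization, only the eigenvalues of A^-1 B.\<close>

definition qform :: "nat \<Rightarrow> complex mat \<Rightarrow> (nat \<Rightarrow> complex) \<Rightarrow> complex" where
  "qform n A v = (\<Sum>i<n. \<Sum>j<n. cnj (v i) * A $$ (i,j) * v j)"

text \<open>Vectors are functions on all naturals, so being nonzero has to be asked of the first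
  \<open>n\<close> coordinates.\<close>

definition pd :: "nat \<Rightarrow> complex mat \<Rightarrow> bool" where
  "pd n A \<longleftrightarrow> A \<in> carrier_mat n n \<and>
     (\<forall>v. (\<exists>i<n. v i \<noteq> 0) \<longrightarrow> Im (qform n A v) = 0 \<and> Re (qform n A v) > 0)"

lemma psd_iff_qform:
  "psd n A \<longleftrightarrow> A \<in> carrier_mat n n \<and> (\<forall>v. Im (qform n A v) = 0 \<and> Re (qform n A v) \<ge> 0)"
  by (simp add: psd_def qform_def Let_def)

lemma qform_add:
  assumes "A \<in> carrier_mat n n" "B \<in> carrier_mat n n"
  shows "qform n (A + B) v = qform n A v + qform n B v"
  using assms by (simp add: qform_def algebra_simps sum.distrib)

lemma qform_smult:
  assumes "A \<in> carrier_mat n n"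
  shows "qform n (a \<cdot>\<^sub>m A) v = a * qform n A v"
  using assms by (simp add: qform_def sum_distrib_left mult_ac)

lemma mult_mat_vec_index_sum:
  assumes "A \<in> carrier_mat m n" "v \<in> carrier_vec n" "i < m"
  shows "(A *\<^sub>v v) $ i = (\<Sum>j<n. A $$ (i,j) * v $ j)"
  using assms by (simp add: scalar_prod_def atLeast0LessThan)

lemma mult_mat_index_sum:
  assumes "A \<in> carrier_mat l m" "B \<in> carrier_mat m n" "i < l" "j < n"
  shows "(A * B) $$ (i,j) = (\<Sum>k<m. A $$ (i,k) * B $$ (k,j))"
  using assms by (simp add: scalar_prod_def atLeast0LessThan)

lemma qform_eq_mult_mat_vec:
  assumes "A \<in> carrier_mat n n" "v \<in> carrier_vec n"
  shows "qform n A (\<lambda>i. v $ i) = (\<Sum>i<n. cnj (v $ i) * (A *\<^sub>v v) $ i)"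
  using assms
  by (auto simp: qform_def mult_mat_vec_index_sum sum_distrib_left mult.assoc
      simp del: index_mult_mat_vec intro!: sum.cong)

lemma pd_nonsingular:
  assumes "pd n A"
  shows "det A \<noteq> 0"
proof
  assume "det A = 0"
  have A: "A \<in> carrier_mat n n" using assms by (simp add: pd_def)
  then obtain v where v: "v \<in> carrier_vec n" "v \<noteq> 0\<^sub>v n" "A *\<^sub>v v = 0\<^sub>v n"
    using \<open>det A = 0\<close> det_0_iff_vec_prod_zero by blast
  have "qform n A (\<lambda>i. v $ i) = 0"
    using v by (simp add: qform_eq_mult_mat_vec[OF A v(1)])
  moreover have "\<exists>i<n. v $ i \<noteq> 0" using v(1,2) by (auto intro!: eq_vecI)
  ultimately show False using assms unfolding pd_def by fastforce
qed

lemma pd_one: "pd n (1\<^sub>m n)"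
  unfolding pd_def
proof (intro conjI allI impI)
  fix v :: "nat \<Rightarrow> complex" assume nz: "\<exists>i<n. v i \<noteq> 0"
  have "qform n (1\<^sub>m n) v = (\<Sum>i<n. \<Sum>j<n. if i = j then cnj (v i) * v i else 0)"
    unfolding qform_def by (intro sum.cong refl) auto
  also have "\<dots> = (\<Sum>i<n. cnj (v i) * v i)" by simp
  also have "\<dots> = (\<Sum>i<n. complex_of_real ((cmod (v i))^2))"
    by (simp add: complex_norm_square mult.commute del: of_real_power)
  finally have q: "qform n (1\<^sub>m n) v = complex_of_real (\<Sum>i<n. (cmod (v i))^2)" by simp
  show "Im (qform n (1\<^sub>m n) v) = 0" by (simp add: q)
  show "Re (qform n (1\<^sub>m n) v) > 0" using nz by (auto simp: q intro!: sum_pos2)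
qed simp

lemma pd_add_psd:
  assumes "pd n A" "psd n B"
  shows "pd n (A + B)"
  using assms unfolding pd_def psd_iff_qform by (auto simp: qform_add add_pos_nonneg)

lemma pd_imp_psd:
  assumes "pd n A"
  shows "psd n A"
  unfolding psd_iff_qform
proof (intro conjI allI)
  show "A \<in> carrier_mat n n" using assms by (simp add: pd_def)
  fix v
  have "qform n A v = 0" if "\<not> (\<exists>i<n. v i \<noteq> 0)" using that by (simp add: qform_def)
  then show "Im (qform n A v) = 0" "Re (qform n A v) \<ge> 0"
    using assms unfolding pd_def by (metis less_imp_le order_refl zero_complex.simps)+
qed

text \<open>Both determinants are read off the characteristic polynomial of \<open>-(A\<^sup>-\<^sup>1 B)\<close>,
  whose roots are real and nonpositive because \<open>B v = \<lambda> A v\<close> makes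
  \<open>\<lambda>\<close> the quotient of the values of the two forms at \<open>v\<close>.\<close>

lemma pd_pencil_factorization:
  assumes pdA: "pd n A" and psdB: "psd n B"
  obtains es :: "real list" where "length es = n" "\<And>e. e \<in> set es \<Longrightarrow> e \<ge> 0"
    "det B = det A * complex_of_real (prod_list es)"
    "det (A + B) = det A * complex_of_real (\<Prod>e\<leftarrow>es. 1 + e)"
proof -
  have A: "A \<in> carrier_mat n n" and B: "B \<in> carrier_mat n n" using assms by (auto simp: pd_def psd_def)
  have "A \<in> Units (ring_mat TYPE(complex) n ())"
    using det_non_zero_imp_unit[OF A pd_nonsingular[OF pdA]] .
  then obtain A' where A': "A' \<in> carrier_mat n n" and inv: "A * A' = 1\<^sub>m n"
    by (auto simp: Units_def ring_mat_def)
  \<comment> \<open>The sign makes the characteristic polynomial at k equal to det (k + A' B); k = 0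
    and k = 1 give the two determinants up to the factor \<open>det A\<close>.\<close>
  define X where "X = - (A' * B)"
  have X: "X \<in> carrier_mat n n" using A' B by (simp add: X_def)
  obtain as where cp: "char_poly X = (\<Prod>a\<leftarrow>as. [:- a, 1:])" and len: "length as = n"
    using char_poly_factorized[OF X] by blast
  have AA'B: "A * (A' * B) = B"
    using A A' B inv by (simp add: assoc_mult_mat[symmetric, of _ n n _ n _ n])
  have neg: "\<exists>e\<ge>0. a = complex_of_real (- e)" if "a \<in> set as" for a
  proof -
    have "poly (char_poly X) a = 0"
      using that unfolding cp by (induction as) auto
    then have "eigenvalue X a" using eigenvalue_root_char_poly[OF X] by simp
    then obtain v where v: "v \<in> carrier_vec n" "v \<noteq> 0\<^sub>v n" "X *\<^sub>v v = a \<cdot>\<^sub>v v"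
      using X by (auto simp: eigenvalue_def eigenvector_def)
    have "A *\<^sub>v (X *\<^sub>v v) = a \<cdot>\<^sub>v (A *\<^sub>v v)" using v A by (simp add: mult_mat_vec[of _ n n])
    moreover have "A *\<^sub>v (X *\<^sub>v v) = - (B *\<^sub>v v)"
    proof -
      have "A *\<^sub>v (X *\<^sub>v v) = (A * X) *\<^sub>v v" using A X v by (simp add: assoc_mult_mat_vec[of _ n n _ n])
      also have "A * X = - B" using AA'B A A' B by (simp add: X_def)
      finally show ?thesis using B v by simp
    qed
    ultimately have eq: "- (B *\<^sub>v v) = a \<cdot>\<^sub>v (A *\<^sub>v v)" by simp
    have q: "qform n B (\<lambda>i. v $ i) = - a * qform n A (\<lambda>i. v $ i)"
    proof -
      have "(B *\<^sub>v v) $ i = - a * (A *\<^sub>v v) $ i" if "i < n" for i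
      proof -
        have "(- (B *\<^sub>v v)) $ i = (a \<cdot>\<^sub>v (A *\<^sub>v v)) $ i" by (simp only: eq)
        then have "- ((B *\<^sub>v v) $ i) = a * (A *\<^sub>v v) $ i"
          using that A B by (simp del: index_mult_mat_vec)
        then show ?thesis by (metis minus_minus mult_minus_left)
      qed
      then show ?thesis
        using A B v by (simp add: qform_eq_mult_mat_vec sum_distrib_left sum_negf mult_ac del: index_mult_mat_vec)
    qed
    have nz: "\<exists>i<n. v $ i \<noteq> 0" using v(1,2) by (auto intro!: eq_vecI)
    have "Im (qform n A (\<lambda>i. v $ i)) = 0 \<and> Re (qform n A (\<lambda>i. v $ i)) > 0"
      using pdA nz unfolding pd_def by blast
    moreover have "Im (qform n B (\<lambda>i. v $ i)) = 0 \<and> Re (qform n B (\<lambda>i. v $ i)) \<ge> 0"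
      using psdB unfolding psd_iff_qform by blast
    ultimately obtain r s :: real where rs: "r > 0" "s \<ge> 0"
      "qform n A (\<lambda>i. v $ i) = of_real r" "qform n B (\<lambda>i. v $ i) = of_real s"
      by (metis complex_is_Real_iff of_real_Re)
    then have "a * of_real r = - of_real s" using q by (metis minus_minus mult_minus_left)
    then have "a = of_real (- (s / r))" using rs(1)
      by (metis divide_minus_left nonzero_eq_divide_eq of_real_divide of_real_eq_0_iff of_real_minus
          order_less_irrefl)
    then show ?thesis using rs by (intro exI[of _ "s/r"]) simp
  qed
  define es where "es = map (\<lambda>a. - Re a) as"
  have as: "as = map (\<lambda>e. - complex_of_real e) es" and pos: "\<And>e. e \<in> set es \<Longrightarrow> e \<ge> 0" and "length es = n"
    using neg len by (force simp: es_def comp_def intro: map_idI[symmetric])+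
  have ev: "poly (char_poly X) k = (\<Prod>e\<leftarrow>es. k + complex_of_real e)" for k
    unfolding cp as by (induction es) (auto simp: algebra_simps)
  have "poly (char_poly X) 0 = det (A' * B)"
    unfolding char_poly_matrix[OF X] using A' B by (intro arg_cong[where f = det] eq_matI) (auto simp: char_matrix_def X_def)
  moreover have "poly (char_poly X) 1 = det (1\<^sub>m n + A' * B)"
    unfolding char_poly_matrix[OF X] using A' B by (intro arg_cong[where f = det] eq_matI) (auto simp: char_matrix_def X_def)
  moreover have "det B = det A * det (A' * B)"
    using det_mult[OF A, of "A' * B"] AA'B A' B by simp
  moreover have "det (A + B) = det A * det (1\<^sub>m n + A' * B)"
    using det_mult[OF A, of "1\<^sub>m n + A' * B"] AA'B A A' B
    by (simp add: mult_add_distrib_mat[OF A one_carrier_mat])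
  moreover have "(\<Prod>e\<leftarrow>es. complex_of_real e) = of_real (prod_list es)"
    and "(\<Prod>e\<leftarrow>es. 1 + complex_of_real e) = of_real (\<Prod>e\<leftarrow>es. 1 + e)"
    by (induction es) auto
  ultimately show ?thesis using that[OF \<open>length es = n\<close> pos] ev[of 0] ev[of 1] by simp
qed

lemma prod_list_real_nonneg:
  fixes es :: "real list"
  assumes "\<And>e. e \<in> set es \<Longrightarrow> e \<ge> 0"
  shows "prod_list es \<ge> 0"
  using assms by (induction es) auto

text \<open>The pencil of the identity and \<open>A\<close> writes \<open>det A\<close> as a product
  of nonnegative reals, and nonsingularity excludes zero.\<close>

lemma pd_det_real_pos:
  assumes "pd n A"
  shows "det A = complex_of_real (Re (det A))" "Re (det A) > 0"
proof -
  obtain es where es: "\<And>e. e \<in> set es \<Longrightarrow> e \<ge> 0"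
    "det A = det (1\<^sub>m n) * complex_of_real (prod_list es)"
    using pd_pencil_factorization[OF pd_one pd_imp_psd[OF assms]] by metis
  then show "det A = complex_of_real (Re (det A))" by simp
  show "Re (det A) > 0"
    using prod_list_real_nonneg[OF es(1)] es(2) pd_nonsingular[OF assms]
    by (simp add: order_less_le)
qed

text \<open>The determinant is a product of factors 1 + e with e \<ge> 0. This keeps the argument of
  the logarithm in the region where \<open>ln\<close> is nonnegative, monotone and
  continuous.\<close>

lemma one_plus_psd_det_ge_1:
  assumes "psd n B"
  shows "Re (det (1\<^sub>m n + B)) \<ge> 1"
proof -
  obtain es where es: "\<And>e. e \<in> set es \<Longrightarrow> e \<ge> 0"
    "det (1\<^sub>m n + B) = det (1\<^sub>m n) * complex_of_real (\<Prod>e\<leftarrow>es. 1 + e)"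
    using pd_pencil_factorization[OF pd_one assms] by metis
  have "(\<Prod>e\<leftarrow>es. 1 + e) \<ge> 1" using es(1)
  proof (induction es)
    case (Cons e es)
    then have "1 * 1 \<le> (1 + e) * (\<Prod>e\<leftarrow>es. 1 + e)" by (intro mult_mono) auto
    then show ?case by simp
  qed simp
  then show ?thesis using es(2) by simp
qed

text \<open>Each factor contributes sqrt e \<le> (1 + e) / 2 in logarithmic form. The power of 1/2
  is the one that a determinant picks up from the scalar 1/2. The two positivity claims travel
  through the induction because splitting the logarithm of a product needs them.\<close>

lemma ln_prod_list_midpoint:
  fixes es :: "real list"
  assumes "\<And>e. e \<in> set es \<Longrightarrow> e > 0"
  shows "prod_list es > 0 \<and> (\<Prod>e\<leftarrow>es. 1 + e) > 0 \<and>
    ln (prod_list es) / 2 \<le> ln ((1/2) ^ length es * (\<Prod>e\<leftarrow>es. 1 + e))"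
  using assms
proof (induction es)
  case (Cons e es)
  define x y where "x = prod_list es" and "y = (\<Prod>e\<leftarrow>es. 1 + e)"
  have IH: "x > 0" "y > 0" "ln x / 2 \<le> ln ((1/2) ^ length es * y)" and e: "e > 0"
    using Cons by (auto simp: x_def y_def)
  have "0 \<le> (1 - e)^2" by simp
  then have "e \<le> ((1 + e) / 2)^2" by (simp add: power2_eq_square field_simps)
  then have "ln e \<le> ln (((1 + e) / 2)^2)" using e by (intro ln_mono) auto
  then have "ln e / 2 \<le> ln ((1 + e) / 2)" using e by (simp add: ln_realpow)
  moreover have "ln (e * x) = ln e + ln x" using e IH by (simp add: ln_mult)
  moreover have "ln ((1/2) ^ length (e # es) * ((1 + e) * y))
      = ln ((1 + e) / 2) + ln ((1/2) ^ length es * y)"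
  proof -
    have "(1/2) ^ length (e # es) * ((1 + e) * y) = (1 + e) / 2 * ((1/2) ^ length es * y)"
      by simp
    then show ?thesis using e IH by (simp only: ln_mult_pos) (intro ln_mult_pos, auto)
  qed
  ultimately show ?case using e IH unfolding x_def y_def by auto
qed simp

text \<open>Once the common term ln (det A) is split off, both sides depend only on the factors of
  the pencil, and the scalar inequality \<open>ln_prod_list_midpoint\<close> is what
  remains.\<close>

lemma pd_ln_det_midpoint:
  assumes pdA: "pd n A" and pdB: "pd n B"
  shows "(ln (Re (det A)) + ln (Re (det B))) / 2 \<le> ln (Re (det ((1/2) \<cdot>\<^sub>m (A + B))))"
proof -
  obtain es where es: "length es = n" "\<And>e. e \<in> set es \<Longrightarrow> e \<ge> 0"
    "det B = det A * complex_of_real (prod_list es)"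
    "det (A + B) = det A * complex_of_real (\<Prod>e\<leftarrow>es. 1 + e)"
    using pd_pencil_factorization[OF pdA pd_imp_psd[OF pdB]] by metis
  have "prod_list es \<noteq> 0" using es(3) pd_nonsingular[OF pdB] by auto
  then have "e > 0" if "e \<in> set es" for e
    using es(2) that by (metis order_le_less prod_list_zero_iff)
  then have *: "prod_list es > 0" "(\<Prod>e\<leftarrow>es. 1 + e) > 0"
    "ln (prod_list es) / 2 \<le> ln ((1/2) ^ length es * (\<Prod>e\<leftarrow>es. 1 + e))"
    using ln_prod_list_midpoint[of es] by blast+
  define r where "r = Re (det A)"
  have r: "det A = complex_of_real r" "r > 0"
    using pd_det_real_pos[OF pdA] by (auto simp: r_def)
  have "A + B \<in> carrier_mat n n" "dim_col B = n" using pdA pdB by (auto simp: pd_def)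
  then have "det ((1/2) \<cdot>\<^sub>m (A + B)) =
      complex_of_real (r * ((1/2) ^ length es * (\<Prod>e\<leftarrow>es. 1 + e)))"
    using es(1) by (simp add: es(4) r(1))
  then have d1: "Re (det ((1/2) \<cdot>\<^sub>m (A + B))) = r * ((1/2) ^ length es * (\<Prod>e\<leftarrow>es. 1 + e))"
    by simp
  have d2: "ln (r * ((1/2) ^ length es * (\<Prod>e\<leftarrow>es. 1 + e)))
      = ln r + ln ((1/2) ^ length es * (\<Prod>e\<leftarrow>es. 1 + e))"
    using * r(2) by (intro ln_mult_pos) auto
  have d3: "Re (det B) = r * prod_list es" by (simp add: es(3) r(1))
  have d4: "ln (r * prod_list es) = ln r + ln (prod_list es)"
    using * r(2) by (intro ln_mult_pos) auto
  show ?thesis unfolding r_def[symmetric] d1 d2 d3 d4 using *(3) by argo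
qed

section \<open>Characteristic functions of random vectors\<close>

text \<open>Levy uniqueness under a change of measure: \<open>g\<close> and \<open>h\<close>,
  normalized by their common mass \<open>Z\<close>, are probability densities, and the hypothesis
  says that \<open>X\<close> under the first and \<open>Y\<close> under the second have the same
  characteristic function. The weights later carry the information about the other
  coordinates.\<close>

lemma (in prob_space) weighted_char_unique:
  fixes X Y g h :: "'a \<Rightarrow> real"
  assumes [measurable]: "X \<in> borel_measurable M" "Y \<in> borel_measurable M"
      "g \<in> borel_measurable M" "h \<in> borel_measurable M" "A \<in> sets borel"
    and g: "\<And>x. 0 \<le> g x \<and> g x \<le> C" and h: "\<And>x. 0 \<le> h x \<and> h x \<le> C"
    and eq: "\<And>t. (LINT x|M. g x *\<^sub>R cis (t * X x)) = (LINT x|M. h x *\<^sub>R cis (t * Y x))"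
  shows "(LINT x|M. g x * indicator A (X x)) = (LINT x|M. h x * indicator A (Y x))"
proof -
  define Z where "Z = (LINT x|M. g x)"
  have int: "integrable M g" "integrable M h"
    using g h by (auto intro!: integrable_const_bound[of _ C])
  have "(LINT x|M. complex_of_real (g x)) = (LINT x|M. complex_of_real (h x))"
    using eq[of 0] by (simp add: scaleR_conv_of_real)
  then have Z': "Z = (LINT x|M. h x)" by (simp add: Z_def)
  show ?thesis
  \<comment> \<open>Without mass there is nothing to normalize, but then both weights vanish almost
    everywhere.\<close>
  proof (cases "Z = 0")
    case True
    then have "AE x in M. g x = 0" "AE x in M. h x = 0"
      using integral_nonneg_eq_0_iff_AE[OF int(1)] integral_nonneg_eq_0_iff_AE[OF int(2)] g h
      by (auto simp: Z_def[symmetric] Z'[symmetric])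
    then have "(LINT x|M. g x * indicator A (X x)) = (LINT x|M. 0)"
      "(LINT x|M. h x * indicator A (Y x)) = (LINT x|M. 0)"
      by (intro integral_cong_AE; force)+
    then show ?thesis by simp
  next
    case False
    moreover have "Z \<ge> 0" unfolding Z_def using g by (intro Bochner_Integration.integral_nonneg) auto
    ultimately have Z: "Z > 0" by simp
    define D where "D f V = distr (density M (\<lambda>x. ennreal (f x / Z))) borel V" for f V :: "'a \<Rightarrow> real"
    have D: "real_distribution (D f V)"
        "\<And>F :: real \<Rightarrow> complex. F \<in> borel_measurable borel \<Longrightarrow>
           integral\<^sup>L (D f V) F = (LINT x|M. (f x / Z) *\<^sub>R F (V x))"
        "\<And>F :: real \<Rightarrow> real. F \<in> borel_measurable borel \<Longrightarrow>
           integral\<^sup>L (D f V) F = (LINT x|M. (f x / Z) *\<^sub>R F (V x))"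
      if [measurable]: "f \<in> borel_measurable M" "V \<in> borel_measurable M" and f: "\<And>x. 0 \<le> f x"
        and intf: "integrable M f" "integral\<^sup>L M f = Z" for f V
    proof -
      have "(\<integral>\<^sup>+x. ennreal (f x / Z) \<partial>M) = ennreal (LINT x|M. f x / Z)"
        using f Z intf by (intro nn_integral_eq_integral) auto
      then have "emeasure (density M (\<lambda>x. ennreal (f x / Z))) (space M) = 1"
        using intf Z by (simp add: emeasure_density cong: nn_integral_cong)
      then interpret d: prob_space "density M (\<lambda>x. ennreal (f x / Z))"
        by (intro prob_spaceI) simp
      show "real_distribution (D f V)" unfolding D_def by (rule d.real_distribution_distr) simp
      show "integral\<^sup>L (D f V) F = (LINT x|M. (f x / Z) *\<^sub>R F (V x))"
        if [measurable]: "F \<in> borel_measurable borel" for F :: "real \<Rightarrow> complex"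
        unfolding D_def using f Z by (simp add: integral_distr integral_density)
      show "integral\<^sup>L (D f V) F = (LINT x|M. (f x / Z) *\<^sub>R F (V x))"
        if [measurable]: "F \<in> borel_measurable borel" for F :: "real \<Rightarrow> real"
        unfolding D_def using f Z by (simp add: integral_distr integral_density)
    qed
    note DX = D[of g X] and DY = D[of h Y]
    have ch: "char (D f V) t = (LINT x|M. f x *\<^sub>R cis (t * V x)) / of_real Z"
      if [measurable]: "f \<in> borel_measurable M" "V \<in> borel_measurable M" and f: "\<And>x. 0 \<le> f x"
        and intf: "integrable M f" "integral\<^sup>L M f = Z" for f V t
    proof -
      have "char (D f V) t = (LINT x|M. (f x / Z) *\<^sub>R cis (t * V x))"
        unfolding char_def by (subst D(2)[OF that]) (auto simp: cis_conv_exp)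
      also have "\<dots> = (LINT x|M. (f x *\<^sub>R cis (t * V x)) / of_real Z)"
        by (simp add: scaleR_conv_of_real)
      finally show ?thesis by simp
    qed
    have "D g X = D h Y"
    proof (rule Levy_uniqueness)
      show "real_distribution (D g X)" "real_distribution (D h Y)"
        using int g h Z' by (auto intro!: D(1) simp: Z_def)
      show "char (D g X) = char (D h Y)"
      proof
        fix t
        have "char (D g X) t = (LINT x|M. g x *\<^sub>R cis (t * X x)) / of_real Z"
          using int g by (intro ch) (auto simp: Z_def)
        also have "\<dots> = (LINT x|M. h x *\<^sub>R cis (t * Y x)) / of_real Z" by (simp add: eq)
        also have "\<dots> = char (D h Y) t"
          using int h Z' by (intro ch[symmetric]) auto
        finally show "char (D g X) t = char (D h Y) t" .
      qed
    qed
    moreover have "integral\<^sup>L (D g X) (indicator A) = (LINT x|M. (g x / Z) *\<^sub>R (indicator A (X x) :: real))"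
      using int g by (intro D(3)) (auto simp: Z_def)
    moreover have "integral\<^sup>L (D h Y) (indicator A) = (LINT x|M. (h x / Z) *\<^sub>R (indicator A (Y x) :: real))"
      using int h Z' by (intro D(3)) auto
    ultimately show ?thesis using Z by simp
  qed
qed

text \<open>Coordinates are passed one at a time from the exponential to the indicator. Under the weight
  \<open>1 + cos (S + \<theta>)\<close>, where \<open>S\<close> is the exponent of the remaining coordinates, the one-dimensional
  uniqueness theorem applies to the coordinate at hand, and varying \<open>\<theta>\<close> recovers \<open>cis S\<close>.\<close>

lemma (in prob_space) char_eq_imp_box_char_eq:
  fixes X Y :: "'i \<Rightarrow> 'a \<Rightarrow> real"
  assumes "finite I" and X[measurable]: "\<And>i. i \<in> I \<Longrightarrow> X i \<in> borel_measurable M"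
    and Y[measurable]: "\<And>i. i \<in> I \<Longrightarrow> Y i \<in> borel_measurable M"
    and A[measurable]: "\<And>i. i \<in> I \<Longrightarrow> A i \<in> sets borel"
    and eq: "\<And>t. (LINT x|M. cis (\<Sum>i\<in>I. t i * X i x)) = (LINT x|M. cis (\<Sum>i\<in>I. t i * Y i x))"
    and "J \<subseteq> I"
  shows "(LINT x|M. (\<Prod>j\<in>J. indicator (A j) (X j x)) *\<^sub>R cis (\<Sum>i\<in>I-J. t i * X i x))
       = (LINT x|M. (\<Prod>j\<in>J. indicator (A j) (Y j x)) *\<^sub>R cis (\<Sum>i\<in>I-J. t i * Y i x))"
proof -
  have "finite J" using assms by (metis finite_subset)
  then show ?thesis using \<open>J \<subseteq> I\<close>
  proof (induction J arbitrary: t)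
    case empty
    then show ?case using eq by simp
  next
    case (insert k J)
    define K where "K = I - insert k J"
    have IJ: "I - J = insert k K" "k \<notin> K" "finite K" "k \<in> I" "K \<subseteq> I" "J \<subseteq> I"
      using insert \<open>finite I\<close> by (auto simp: K_def)
    define g where "g V x = (\<Prod>j\<in>J. indicator (A j) (V j x) :: real)" for V :: "'i \<Rightarrow> 'a \<Rightarrow> real" and x
    define S where "S V x = (\<Sum>i\<in>K. t i * V i x)" for V :: "'i \<Rightarrow> 'a \<Rightarrow> real" and x
    have g01: "0 \<le> g V x" "g V x \<le> 1" for V x
      unfolding g_def by (auto intro!: prod_nonneg prod_le_1)
    have [measurable]: "g X \<in> borel_measurable M" "g Y \<in> borel_measurable M"
      "S X \<in> borel_measurable M" "S Y \<in> borel_measurable M"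
      "X k \<in> borel_measurable M" "Y k \<in> borel_measurable M" "A k \<in> sets borel"
      using IJ A X Y unfolding g_def[abs_def] S_def[abs_def]
      by (auto intro!: borel_measurable_prod borel_measurable_sum borel_measurable_times
          measurable_compose[of _ M borel "indicator _"] subsetD[OF IJ(5)] subsetD[OF IJ(6)])
    \<comment> \<open>Both parameters come from the freedom in \<open>t\<close>: \<open>s\<close>
      becomes the variable of a one-dimensional characteristic function, and \<open>r\<close> takes
      the values 0, 1, -1, the frequencies of \<open>S\<close> in the weight.\<close>
    have IH: "(LINT x|M. g X x *\<^sub>R cis (s * X k x + r * S X x))
            = (LINT x|M. g Y x *\<^sub>R cis (s * Y k x + r * S Y x))" for s r
    proof -
      have "(\<Sum>i\<in>I-J. (if i = k then s else r * t i) * V i x) = s * V k x + r * S V x" for V x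
        using IJ by (auto simp: S_def sum_distrib_left mult.assoc intro!: sum.cong)
      then show ?thesis
        using insert.IH[of "\<lambda>i. if i = k then s else r * t i"] IJ by (simp add: g_def)
    qed
    \<comment> \<open>The cosine is half the sum of \<open>cis\<close> and its conjugate, so the
      integral splits into three that \<open>IH\<close> controls. The added 1 keeps the weight
      nonnegative, as a density must be.\<close>
    have weight: "(LINT x|M. (g V x * (1 + cos (S V x + \<theta>))) *\<^sub>R cis (s * V k x))
       = (LINT x|M. g V x *\<^sub>R cis (s * V k x + 0 * S V x))
         + cis \<theta> / 2 * (LINT x|M. g V x *\<^sub>R cis (s * V k x + 1 * S V x))
         + cis (-\<theta>) / 2 * (LINT x|M. g V x *\<^sub>R cis (s * V k x + (-1) * S V x))"
      if [measurable]: "g V \<in> borel_measurable M" "S V \<in> borel_measurable M" "V k \<in> borel_measurable M"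
      for V \<theta> s
    proof -
      have int: "integrable M (\<lambda>x. g V x *\<^sub>R cis (s * V k x + r * S V x))" for r
        using g01 by (intro integrable_const_bound[of _ 1]) (auto simp: cis_conv_exp)
      have cos: "complex_of_real (cos (u + \<theta>)) = (cis u * cis \<theta> + cis (-u) * cis (-\<theta>)) / 2" for u
        by (simp add: complex_eq_iff cos_add sin_add)
      have cis: "cis (p + 0 * q) = cis p" "cis (p + 1 * q) = cis p * cis q"
        "cis (p + (-1) * q) = cis p * cis (-q)" for p q
        by (simp_all add: cis_mult)
      have "(g V x * (1 + cos (S V x + \<theta>))) *\<^sub>R cis (s * V k x)
         = g V x *\<^sub>R cis (s * V k x + 0 * S V x)
         + cis \<theta> / 2 * (g V x *\<^sub>R cis (s * V k x + 1 * S V x))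
         + cis (-\<theta>) / 2 * (g V x *\<^sub>R cis (s * V k x + (-1) * S V x))" for x
        unfolding cis scaleR_conv_of_real of_real_mult of_real_add of_real_1 cos
        by (simp add: algebra_simps add_divide_distrib)
      then show ?thesis
        using int[of 0] int[of 1] int[of "-1"]
        by (simp only: Bochner_Integration.integral_add integral_mult_right_zero
            Bochner_Integration.integrable_add integrable_mult_right)
    qed
    have *: "(LINT x|M. g X x * (1 + cos (S X x + \<theta>)) * indicator (A k) (X k x))
           = (LINT x|M. g Y x * (1 + cos (S Y x + \<theta>)) * indicator (A k) (Y k x))" for \<theta>
    proof (rule weighted_char_unique[where C = 2])
      show "(LINT x|M. (g X x * (1 + cos (S X x + \<theta>))) *\<^sub>R cis (s * X k x)) =
            (LINT x|M. (g Y x * (1 + cos (S Y x + \<theta>))) *\<^sub>R cis (s * Y k x))" for s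
        by (simp only: weight[of X] weight[of Y] IH \<open>g X \<in> _\<close> \<open>g Y \<in> _\<close> \<open>S X \<in> _\<close> \<open>S Y \<in> _\<close>
            \<open>X k \<in> _\<close> \<open>Y k \<in> _\<close>)
      have "0 \<le> 1 + cos u \<and> 1 + cos u \<le> 2" for u :: real
        using cos_ge_minus_one[of u] cos_le_one[of u] by linarith
      then show "0 \<le> g V x * (1 + cos (S V x + \<theta>)) \<and> g V x * (1 + cos (S V x + \<theta>)) \<le> 2" for V x
        using g01[of V x] mult_mono[of "g V x" 1 "1 + cos (S V x + \<theta>)" 2] by auto
      then show "0 \<le> g V x * (1 + cos (S V x + \<theta>)) \<and> g V x * (1 + cos (S V x + \<theta>)) \<le> 2" for V x .
    qed measurable
    define G where "G V x = g V x * indicator (A k) (V k x)" for V :: "'i \<Rightarrow> 'a \<Rightarrow> real" and x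
    have [measurable]: "G X \<in> borel_measurable M" "G Y \<in> borel_measurable M"
      unfolding G_def[abs_def] by measurable
    have G01: "0 \<le> G V x" "G V x \<le> 1" for V x
      using g01[of V x] by (auto simp: G_def indicator_def)
    have intG: "integrable M (\<lambda>x. G V x * cos (S V x + \<theta>))" "integrable M (G V)"
      if [measurable]: "G V \<in> borel_measurable M" "S V \<in> borel_measurable M" for V \<theta>
    proof -
      show "integrable M (\<lambda>x. G V x * cos (S V x + \<theta>))"
        using G01[of V] by (intro integrable_const_bound[of _ 1]) (auto simp: abs_mult intro!: mult_le_one)
      show "integrable M (G V)"
        using G01[of V] by (intro integrable_const_bound[of _ 1]) auto
    qed
    have split: "(LINT x|M. g V x * (1 + cos (S V x + \<theta>)) * indicator (A k) (V k x))
        = (LINT x|M. G V x) + (LINT x|M. G V x * cos (S V x + \<theta>))"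
      if "G V \<in> borel_measurable M" "S V \<in> borel_measurable M" for V \<theta>
    proof -
      have "g V x * (1 + cos (S V x + \<theta>)) * indicator (A k) (V k x)
          = G V x + G V x * cos (S V x + \<theta>)" for x
        by (simp add: G_def algebra_simps)
      then show ?thesis using intG[OF that] by (simp only: Bochner_Integration.integral_add)
    qed
    have neg: "(LINT x|M. G V x * cos (S V x + pi)) = - (LINT x|M. G V x * cos (S V x + 0))" for V
      by simp
    have sum: "(LINT x|M. G X x) + (LINT x|M. G X x * cos (S X x + \<theta>))
        = (LINT x|M. G Y x) + (LINT x|M. G Y x * cos (S Y x + \<theta>))" for \<theta>
      using *[of \<theta>] by (simp only: split \<open>G X \<in> _\<close> \<open>G Y \<in> _\<close> \<open>S X \<in> _\<close> \<open>S Y \<in> _\<close>)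
    \<comment> \<open>The phases 0 and pi have opposite cosines, so adding the two instances
      isolates the integral of \<open>G\<close>. Subtracting it again frees the cosine part for
      every phase.\<close>
    have "(LINT x|M. G X x) = (LINT x|M. G Y x)" using sum[of 0] sum[of pi] neg[of X] neg[of Y] by linarith
    then have cosG: "(LINT x|M. G X x * cos (S X x + \<theta>)) = (LINT x|M. G Y x * cos (S Y x + \<theta>))" for \<theta>
      using sum[of \<theta>] by linarith
    have cisG: "(LINT x|M. G V x *\<^sub>R cis (S V x)) = complex_of_real (LINT x|M. G V x * cos (S V x + 0))
          + \<i> * complex_of_real (LINT x|M. G V x * cos (S V x + (- (pi/2))))"
      if "G V \<in> borel_measurable M" "S V \<in> borel_measurable M" for V
    proof -
      have "cos (u - pi/2) = sin u" for u :: real by (simp add: cos_diff)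
      then have "G V x *\<^sub>R cis (S V x) = complex_of_real (G V x * cos (S V x + 0))
          + \<i> * complex_of_real (G V x * cos (S V x + (- (pi/2))))" for x
        by (simp add: complex_eq_iff)
      then show ?thesis
        using intG(1)[OF that, of 0] intG(1)[OF that, of "- (pi/2)"]
        by (simp del: of_real_mult)
    qed
    have "(LINT x|M. G X x *\<^sub>R cis (S X x)) = (LINT x|M. G Y x *\<^sub>R cis (S Y x))"
      by (simp only: cisG \<open>G X \<in> _\<close> \<open>G Y \<in> _\<close> \<open>S X \<in> _\<close> \<open>S Y \<in> _\<close> cosG)
    moreover have "G V x = (\<Prod>j\<in>insert k J. indicator (A j) (V j x))" for V x
      using insert.hyps by (simp add: G_def g_def mult.commute)
    ultimately show ?case by (simp only: S_def K_def)
  qed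
qed

text \<open>With \<open>J = I\<close> the exponent in \<open>char_eq_imp_box_char_eq\<close> is an
  empty sum and the identity compares the probabilities of boxes. Boxes determine a finite measure
  on the product, so the joint laws coincide. Integrability of \<open>f\<close> is not at issue, as
  both sides are the integral of \<open>f\<close> against one and the same law.\<close>

lemma (in prob_space) char_eq_imp_integral_eq:
  fixes X Y :: "'i \<Rightarrow> 'a \<Rightarrow> real" and f :: "('i \<Rightarrow> real) \<Rightarrow> real"
  assumes "finite I" and X[measurable]: "\<And>i. i \<in> I \<Longrightarrow> X i \<in> borel_measurable M"
    and Y[measurable]: "\<And>i. i \<in> I \<Longrightarrow> Y i \<in> borel_measurable M"
    and eq: "\<And>t. (LINT x|M. cis (\<Sum>i\<in>I. t i * X i x)) = (LINT x|M. cis (\<Sum>i\<in>I. t i * Y i x))"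
    and [measurable]: "f \<in> borel_measurable (PiM I (\<lambda>_. borel))"
  shows "(LINT x|M. f (\<lambda>i\<in>I. X i x)) = (LINT x|M. f (\<lambda>i\<in>I. Y i x))"
proof -
  define T where "T V x = (\<lambda>i\<in>I. V i x)" for V :: "'i \<Rightarrow> 'a \<Rightarrow> real" and x
  have [measurable]: "T X \<in> measurable M (PiM I (\<lambda>_. borel))" "T Y \<in> measurable M (PiM I (\<lambda>_. borel))"
    unfolding T_def[abs_def] by (auto intro!: measurable_restrict)
  have box: "emeasure (distr M (PiM I (\<lambda>_. borel)) (T V)) (PiE I A)
      = ennreal (LINT x|M. (\<Prod>i\<in>I. indicator (A i) (V i x)))"
    if [measurable]: "T V \<in> measurable M (PiM I (\<lambda>_. borel))"
      and A: "\<And>i. i \<in> I \<Longrightarrow> A i \<in> sets borel" for V A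
  proof -
    have B[measurable]: "PiE I A \<in> sets (PiM I (\<lambda>_. borel))"
      using A \<open>finite I\<close> by (intro sets_PiM_I_finite) auto
    have "emeasure (distr M (PiM I (\<lambda>_. borel)) (T V)) (PiE I A)
        = ennreal (measure M (T V -` PiE I A \<inter> space M))"
      by (simp add: emeasure_distr emeasure_eq_measure)
    also have "measure M (T V -` PiE I A \<inter> space M)
        = (LINT x|M. indicator (T V -` PiE I A \<inter> space M) x)" by simp
    also have "\<dots> = (LINT x|M. (\<Prod>i\<in>I. indicator (A i) (V i x)))"
    proof (rule Bochner_Integration.integral_cong)
      fix x assume "x \<in> space M"
      then show "indicator (T V -` PiE I A \<inter> space M) x = (\<Prod>i\<in>I. indicator (A i) (V i x) :: real)"
        using \<open>finite I\<close> by (auto simp: T_def indicator_def prod_zero_iff PiE_iff)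
    qed simp
    finally show ?thesis .
  qed
  have "distr M (PiM I (\<lambda>_. borel)) (T X) = distr M (PiM I (\<lambda>_. borel)) (T Y)"
  proof (rule measure_eqI_PiM_finite[where A = "\<lambda>_. space (PiM I (\<lambda>_. borel))"])
    fix A :: "'i \<Rightarrow> real set" assume A: "\<And>i. i \<in> I \<Longrightarrow> A i \<in> sets borel"
    have "complex_of_real (LINT x|M. (\<Prod>i\<in>I. indicator (A i) (X i x)))
        = complex_of_real (LINT x|M. (\<Prod>i\<in>I. indicator (A i) (Y i x)))"
      using char_eq_imp_box_char_eq[OF \<open>finite I\<close> X Y A eq order_refl]
      by (simp add: scaleR_conv_of_real flip: integral_complex_of_real)
    then show "emeasure (distr M (PiM I (\<lambda>_. borel)) (T X)) (PiE I A)
        = emeasure (distr M (PiM I (\<lambda>_. borel)) (T Y)) (PiE I A)"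
      using A by (simp add: box)
  next
    \<comment> \<open>The laws are finite, so the whole space, repeated, serves as the exhausting
      sequence of sets of finite measure.\<close>
    show "range (\<lambda>_::nat. space (PiM I (\<lambda>_. borel))) \<subseteq> prod_algebra I (\<lambda>_. borel :: real measure)"
      by (auto simp: space_PiM intro!: prod_algebraI_finite \<open>finite I\<close>)
  qed (auto simp: \<open>finite I\<close> emeasure_distr emeasure_eq_measure)
  moreover have "(LINT x|M. f (T V x)) = integral\<^sup>L (distr M (PiM I (\<lambda>_. borel)) (T V)) f"
    if [measurable]: "T V \<in> measurable M (PiM I (\<lambda>_. borel))" for V
    by (simp add: integral_distr)
  ultimately show ?thesis by (simp add: T_def)
qed

text \<open>A second difference of the characteristic function at 0 recovers the second moment: k^2
  (1 - cos (X/k)) tends to X^2/2, while its mean k^2 (1 - exp (-v/k^2)) never exceeds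
  \<open>v\<close>. Fatou's lemma passes the bound to the limit.\<close>

lemma (in prob_space) char_quadratic_imp_square_integrable:
  fixes X :: "'a \<Rightarrow> real"
  assumes [measurable]: "X \<in> borel_measurable M"
    and char: "\<And>t. (LINT x|M. cis (t * X x)) = complex_of_real (exp (- (v * t^2)))"
  shows "integrable M (\<lambda>x. (X x)^2)"
proof -
  define F where "F n x = real (Suc n)^2 * (1 - cos (X x / real (Suc n)))" for n x
  have [measurable]: "F n \<in> borel_measurable M" for n unfolding F_def by measurable
  have F0: "F n x \<ge> 0" for n x by (simp add: F_def)
  have intc: "integrable M (\<lambda>x. cos (t * X x))" "integrable M (\<lambda>x. cis (t * X x))" for t
    by (auto intro!: integrable_const_bound[of _ 1] simp: cis_conv_exp)
  have bound: "(\<integral>\<^sup>+x. ennreal (F n x) \<partial>M) \<le> ennreal v" for n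
  proof -
    define t where "t = 1 / real (Suc n)"
    have t: "real (Suc n)^2 * t^2 = 1" by (simp add: t_def power_divide)
    have "(LINT x|M. cos (t * X x)) = Re (LINT x|M. cis (t * X x))"
      using integral_Re[OF intc(2)[of t]] by simp
    also have "\<dots> = exp (- (v * t^2))" by (simp add: char)
    finally have c: "(LINT x|M. cos (t * X x)) = exp (- (v * t^2))" .
    have F: "F n = (\<lambda>x. real (Suc n)^2 * (1 - cos (t * X x)))" by (auto simp: F_def t_def)
    have "integrable M (F n)" unfolding F using intc(1) by simp
    then have "(\<integral>\<^sup>+x. ennreal (F n x) \<partial>M) = ennreal (LINT x|M. F n x)"
      using F0 by (intro nn_integral_eq_integral) auto
    also have "(LINT x|M. F n x) = real (Suc n)^2 * (1 - exp (- (v * t^2)))"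
      unfolding F using intc(1) by (simp add: c prob_space)
    also have "\<dots> \<le> real (Suc n)^2 * (v * t^2)"
      using exp_ge_add_one_self[of "- (v * t^2)"] by (intro mult_left_mono) auto
    also have "\<dots> = v" using t by (metis mult.commute mult.left_commute mult_1_right)
    finally show ?thesis by (simp add: ennreal_leI)
  qed
  have lim: "(\<lambda>n. F n x) \<longlonglongrightarrow> (X x)^2 / 2" for x
  proof (cases "X x = 0")
    case False
    \<comment> \<open>Half the angle: 1 - cos (2 y) = 2 (sin y)^2 expresses \<open>F n x\<close>
      through the quotient sin y / y.\<close>
    define y where "y n = X x / 2 / real (Suc n)" for n
    have "((\<lambda>h. sin h / h) \<longlongrightarrow> 1) (at (0::real))"
      using DERIV_sin[of 0] by (simp add: DERIV_def)
    moreover have "filterlim y (at 0) sequentially"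
      unfolding y_def[abs_def] filterlim_at
      using False lim_const_over_n[of "X x / 2"] by (auto simp del: of_nat_Suc intro: LIMSEQ_Suc)
    ultimately have "(\<lambda>n. sin (y n) / y n) \<longlonglongrightarrow> 1" by (rule filterlim_compose)
    then have "(\<lambda>n. 2 * (X x / 2 * (sin (y n) / y n))^2) \<longlonglongrightarrow> 2 * (X x / 2 * 1)^2"
      by (intro tendsto_intros)
    moreover have "F n x = 2 * (X x / 2 * (sin (y n) / y n))^2" for n
    proof -
      have "cos (X x / real (Suc n)) = 1 - 2 * (sin (y n))^2"
        using cos_double_sin[of "y n"] by (simp add: y_def del: of_nat_Suc)
      moreover have "X x / 2 * (sin (y n) / y n) = real (Suc n) * sin (y n)"
        using False by (simp add: y_def del: of_nat_Suc)
      ultimately show ?thesis by (simp add: F_def power_mult_distrib)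
    qed
    ultimately show ?thesis by (simp add: power_divide)
  qed (simp add: F_def)
  have "(\<integral>\<^sup>+x. ennreal ((X x)^2 / 2) \<partial>M) = (\<integral>\<^sup>+x. liminf (\<lambda>n. ennreal (F n x)) \<partial>M)"
  proof (rule nn_integral_cong)
    fix x
    have "(\<lambda>n. ennreal (F n x)) \<longlonglongrightarrow> ennreal ((X x)^2 / 2)" using lim by (intro tendsto_ennrealI)
    then show "ennreal ((X x)^2 / 2) = liminf (\<lambda>n. ennreal (F n x))"
      by (simp add: lim_imp_Liminf)
  qed
  also have "\<dots> \<le> liminf (\<lambda>n. \<integral>\<^sup>+x. ennreal (F n x) \<partial>M)" by (intro nn_integral_liminf) simp
  also have "\<dots> \<le> ennreal v"
    using bound by (intro Liminf_le) (auto intro: always_eventually)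
  also have "\<dots> < \<infinity>" by simp
  finally have "integrable M (\<lambda>x. (X x)^2 / 2)"
    by (intro integrableI_nonneg) auto
  from integrable_mult_right[OF this, of 2] show ?thesis by simp
qed

section \<open>The log-determinant of a channel\<close>

lemma adj_carrier [simp]: "A \<in> carrier_mat m n \<Longrightarrow> adj A \<in> carrier_mat n m"
  by (simp add: adj_def)

lemma adj_index [simp]: "i < dim_col A \<Longrightarrow> j < dim_row A \<Longrightarrow> adj A $$ (i,j) = cnj (A $$ (j,i))"
  by (simp add: adj_def)

lemma adj_mult:
  assumes "A \<in> carrier_mat l m" "B \<in> carrier_mat m n"
  shows "adj (A * B) = adj B * adj A"
  using assms by (intro eq_matI) (auto simp: mult_mat_index_sum[of _ l m _ n] adj_def
    scalar_prod_def mult.commute)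

lemma congruence_carrier:
  assumes "h \<in> carrier_mat m n" "Q \<in> carrier_mat n n"
  shows "h * Q * adj h \<in> carrier_mat m m"
  using mult_carrier_mat[OF mult_carrier_mat[OF assms] adj_carrier[OF assms(1)]] .

lemma congruence_index:
  assumes "h \<in> carrier_mat m n" "Q \<in> carrier_mat n n" "i < m" "j < m"
  shows "(h * Q * adj h) $$ (i,j) = (\<Sum>k<n. \<Sum>l<n. h $$ (i,k) * Q $$ (k,l) * cnj (h $$ (j,l)))"
proof -
  have "(h * Q * adj h) $$ (i,j) = (\<Sum>l<n. \<Sum>k<n. h $$ (i,k) * Q $$ (k,l) * cnj (h $$ (j,l)))"
    using assms
    by (simp add: mult_mat_index_sum[of _ m n _ m] mult_mat_index_sum[of _ m n _ n]
        sum_distrib_right del: index_mult_mat)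
  also have "\<dots> = (\<Sum>k<n. \<Sum>l<n. h $$ (i,k) * Q $$ (k,l) * cnj (h $$ (j,l)))"
    by (rule sum.swap)
  finally show ?thesis .
qed

text \<open>Limits and measurability of the log-determinant, and its upper bound, are proved entry
  by entry from this polynomial in the entries of \<open>h\<close>, their conjugates and the entries
  of \<open>Q\<close>.\<close>

lemma one_plus_congruence_index:
  assumes "h \<in> carrier_mat m n" "Q \<in> carrier_mat n n" "i < m" "j < m"
  shows "(1\<^sub>m m + c \<cdot>\<^sub>m (h * Q * adj h)) $$ (i,j) = (if i = j then 1 else 0)
      + c * (\<Sum>k<n. \<Sum>l<n. h $$ (i,k) * Q $$ (k,l) * cnj (h $$ (j,l)))"
proof -
  note C = congruence_carrier[OF assms(1,2)]
  have "(1\<^sub>m m + c \<cdot>\<^sub>m (h * Q * adj h)) $$ (i,j)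
      = 1\<^sub>m m $$ (i,j) + c * (h * Q * adj h) $$ (i,j)"
    using C assms(3,4) by (metis index_add_mat(1) index_smult_mat carrier_matD)
  then show ?thesis using assms by (simp only: congruence_index index_one_mat)
qed

text \<open>The form of \<open>h * Q * adj h\<close> at v is the form of \<open>Q\<close> at h^H v;
  the proof only reorders a fourfold sum.\<close>

lemma psd_congruence:
  assumes h: "h \<in> carrier_mat m n" and Q: "psd n Q"
  shows "psd m (h * Q * adj h)"
proof -
  have Qc: "Q \<in> carrier_mat n n" using Q by (simp add: psd_def)
  have "qform m (h * Q * adj h) v = qform n Q (\<lambda>k. \<Sum>i<m. cnj (h $$ (i,k)) * v i)" for v
  proof -
    have "qform m (h * Q * adj h) v = (\<Sum>i<m. \<Sum>j<m. \<Sum>k<n. \<Sum>l<n.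
        cnj (v i) * h $$ (i,k) * Q $$ (k,l) * (cnj (h $$ (j,l)) * v j))"
      using h Qc by (simp add: qform_def congruence_index sum_distrib_left sum_distrib_right mult_ac
        del: index_mult_mat)
    also have "\<dots> = (\<Sum>i<m. \<Sum>k<n. \<Sum>j<m. \<Sum>l<n.
        cnj (v i) * h $$ (i,k) * Q $$ (k,l) * (cnj (h $$ (j,l)) * v j))"
      by (intro sum.cong refl sum.swap)
    also have "\<dots> = (\<Sum>k<n. \<Sum>i<m. \<Sum>l<n. \<Sum>j<m.
        cnj (v i) * h $$ (i,k) * Q $$ (k,l) * (cnj (h $$ (j,l)) * v j))"
      by (subst sum.swap) (intro sum.cong refl sum.swap)
    also have "\<dots> = (\<Sum>k<n. \<Sum>l<n. \<Sum>i<m. \<Sum>j<m.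
        cnj (v i) * h $$ (i,k) * Q $$ (k,l) * (cnj (h $$ (j,l)) * v j))"
      by (intro sum.cong refl sum.swap)
    also have "\<dots> = qform n Q (\<lambda>k. \<Sum>i<m. cnj (h $$ (i,k)) * v i)"
      by (simp add: qform_def sum_distrib_left sum_distrib_right mult_ac)
    finally show ?thesis .
  qed
  then show ?thesis using congruence_carrier[OF h Qc] Q by (simp add: psd_iff_qform)
qed

section \<open>The cone of positive semidefinite matrices and bounds on entries\<close>

lemma psd_add: "psd n A \<Longrightarrow> psd n B \<Longrightarrow> psd n (A + B)"
  by (auto simp: psd_iff_qform qform_add)

lemma psd_smult: "psd n A \<Longrightarrow> 0 \<le> a \<Longrightarrow> psd n (complex_of_real a \<cdot>\<^sub>m A)"
  by (auto simp: psd_iff_qform qform_smult)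

lemma psd_zero: "psd n (0\<^sub>m n n)"
  by (simp add: psd_iff_qform qform_def)

text \<open>The test vector is e_k + u e_l; the values 1, -1, i, -i of \<open>u\<close> polarize the
  form and isolate an off-diagonal entry.\<close>

lemma qform_two_points:
  assumes "k < n" "l < n" "k \<noteq> l"
  shows "qform n A (\<lambda>i. if i = k then 1 else if i = l then u else 0) =
    A $$ (k,k) + u * A $$ (k,l) + cnj u * A $$ (l,k) + cnj u * u * A $$ (l,l)"
proof -
  have "(\<Sum>j<n. A $$ (i,j) * (if j = k then 1 else if j = l then u else 0)) = A $$ (i,k) + u * A $$ (i,l)" for i
  proof -
    have "A $$ (i,j) * (if j = k then 1 else if j = l then u else 0) =
        (if j = k then A $$ (i,k) else 0) + (if j = l then u * A $$ (i,l) else 0)" for j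
      using assms by auto
    then show ?thesis using assms by (simp add: sum.distrib)
  qed
  then have "qform n A (\<lambda>i. if i = k then 1 else if i = l then u else 0) =
      (\<Sum>i<n. cnj (if i = k then 1 else if i = l then u else 0) * (A $$ (i,k) + u * A $$ (i,l)))"
    by (simp add: qform_def sum_distrib_left[symmetric] mult.assoc)
  also have "\<dots> = (\<Sum>i<n. (if i = k then A $$ (k,k) + u * A $$ (k,l) else 0)
      + (if i = l then cnj u * (A $$ (l,k) + u * A $$ (l,l)) else 0))"
    using assms by (intro sum.cong) auto
  finally show ?thesis using assms by (simp add: sum.distrib algebra_simps)
qed

lemma psd_diag:
  assumes "psd n A" "k < n"
  shows "Im (A $$ (k,k)) = 0" "Re (A $$ (k,k)) \<ge> 0"
proof -
  have "qform n A (\<lambda>i. if i = k then 1 else 0) = (\<Sum>i<n. if i = k then A $$ (k,k) else 0)"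
    unfolding qform_def
  proof (intro sum.cong refl)
    fix i
    have "(\<Sum>j<n. cnj (if i = k then 1 else 0) * A $$ (i,j) * (if j = k then 1 else 0))
        = (\<Sum>j<n. if j = k then (if i = k then A $$ (k,k) else 0) else 0)"
      by (intro sum.cong) auto
    then show "(\<Sum>j<n. cnj (if i = k then 1 else 0) * A $$ (i,j) * (if j = k then 1 else 0))
        = (if i = k then A $$ (k,k) else 0)"
      using assms by simp
  qed
  also have "\<dots> = A $$ (k,k)" using assms by simp
  finally show "Im (A $$ (k,k)) = 0" "Re (A $$ (k,k)) \<ge> 0"
    using assms(1) unfolding psd_iff_qform by metis+
qed

text \<open>A trace constraint thus bounds all entries, which is the boundedness half of
  compactness. Polarization bounds the real and the imaginary part of an off-diagonal entry by the
  trace each; the constant 2 is their sum.\<close>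

lemma psd_entry_le_trace:
  assumes A: "psd n A" and "k < n" "l < n"
  shows "cmod (A $$ (k,l)) \<le> 2 * Re (mtrace A)"
proof -
  have "dim_row A = n" using A by (auto simp: psd_def)
  then have tr: "Re (mtrace A) = (\<Sum>i<n. Re (A $$ (i,i)))" by (simp add: mtrace_def)
  have le: "Re (A $$ (i,i)) \<le> Re (mtrace A)" if "i < n" for i
    unfolding tr using that psd_diag[OF A] by (intro member_le_sum) auto
  show ?thesis
  proof (cases "k = l")
    case True
    then have "cmod (A $$ (k,l)) = Re (A $$ (k,k))"
      using psd_diag[OF A \<open>k < n\<close>] by (simp add: cmod_eq_Re)
    then show ?thesis using le[OF \<open>k < n\<close>] psd_diag[OF A \<open>k < n\<close>] by linarith
  next
    case False
    define q where "q u = A $$ (k,k) + u * A $$ (k,l) + cnj u * A $$ (l,k) + cnj u * u * A $$ (l,l)" for u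
    have q: "Im (q u) = 0" "Re (q u) \<ge> 0" for u
      using A unfolding psd_iff_qform q_def qform_two_points[OF assms(2,3) False, symmetric] by blast+
    \<comment> \<open>Hermitian symmetry has to be extracted from the form being real: u = 1 relates
      the imaginary parts, u = i the real parts.\<close>
    have herm: "Im (A $$ (l,k)) = - Im (A $$ (k,l))" "Re (A $$ (l,k)) = Re (A $$ (k,l))"
      using q(1)[of 1] q(1)[of \<i>] psd_diag[OF A \<open>k < n\<close>] psd_diag[OF A \<open>l < n\<close>]
      by (auto simp: q_def)
    have "\<bar>Re (A $$ (k,l))\<bar> \<le> Re (mtrace A)"
      using q(2)[of 1] q(2)[of "-1"] le[OF \<open>k < n\<close>] le[OF \<open>l < n\<close>] herm by (simp add: q_def abs_le_iff)
    moreover have "\<bar>Im (A $$ (k,l))\<bar> \<le> Re (mtrace A)"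
      using q(2)[of \<i>] q(2)[of "-\<i>"] le[OF \<open>k < n\<close>] le[OF \<open>l < n\<close>] herm by (simp add: q_def abs_le_iff)
    ultimately show ?thesis using cmod_le[of "A $$ (k,l)"] by linarith
  qed
qed

section \<open>Concavity, growth, continuity and measurability of the log-determinant\<close>

definition logdet :: "complex mat \<Rightarrow> real \<Rightarrow> complex mat \<Rightarrow> real" where
  "logdet h a Q = ln (Re (det (1\<^sub>m (dim_row h) + complex_of_real a \<cdot>\<^sub>m (h * Q * adj h))))"

lemma logdet_nonneg:
  assumes "h \<in> carrier_mat m n" "psd n Q" "a \<ge> 0"
  shows "logdet h a Q \<ge> 0"
  using one_plus_psd_det_ge_1[OF psd_smult[OF psd_congruence[OF assms(1,2)] assms(3)]] assms
  by (simp add: logdet_def)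

lemma congruence_add:
  fixes h :: "complex mat"
  assumes "h \<in> carrier_mat m n" "A \<in> carrier_mat n n" "B \<in> carrier_mat n n"
  shows "h * (A + B) * adj h = h * A * adj h + h * B * adj h"
  using assms
  by (simp add: mult_add_distrib_mat[of h m n] add_mult_distrib_mat[of _ m n _ "adj h" m])

text \<open>\<open>Q\<close> enters the argument of the determinant affinely, and the two identity
  matrices average to one, so concavity of ln det carries over.\<close>

lemma logdet_midpoint:
  assumes h: "h \<in> carrier_mat m n" and A: "psd n A" and B: "psd n B" and a: "a \<ge> 0"
  shows "(logdet h a A + logdet h a B) / 2 \<le> logdet h a ((1/2) \<cdot>\<^sub>m (A + B))"
proof -
  have c: "A \<in> carrier_mat n n" "B \<in> carrier_mat n n" using A B by (auto simp: psd_def)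
  define X where "X Q = 1\<^sub>m m + complex_of_real a \<cdot>\<^sub>m (h * Q * adj h)" for Q
  have pd: "pd m (X Q)" if "psd n Q" for Q
    unfolding X_def by (intro pd_add_psd pd_one psd_smult psd_congruence[OF h that] a)
  have "X ((1/2) \<cdot>\<^sub>m (A + B)) = (1/2) \<cdot>\<^sub>m (X A + X B)"
  proof -
    have "h * ((1/2) \<cdot>\<^sub>m (A + B)) * adj h = (1/2) \<cdot>\<^sub>m (h * (A + B) * adj h)"
      using h c by (simp add: mult_smult_distrib[of h m n _ n] mult_smult_assoc_mat[of _ m n _ m])
    also have "\<dots> = (1/2) \<cdot>\<^sub>m (h * A * adj h + h * B * adj h)" using h c by (simp add: congruence_add)
    finally show ?thesis unfolding X_def using h c
      by (intro eq_matI) (auto simp: algebra_simps simp del: index_mult_mat(1))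
  qed
  then show ?thesis
    using pd_ln_det_midpoint[OF pd[OF A] pd[OF B]] h unfolding logdet_def X_def by simp
qed

text \<open>The Leibniz formula has m! terms. So crude a bound is enough, because under the
  logarithm the factorial becomes a constant summand and the power a factor.\<close>

lemma det_norm_le:
  assumes A: "A \<in> carrier_mat m m" and b: "\<And>i j. i < m \<Longrightarrow> j < m \<Longrightarrow> cmod (A $$ (i,j)) \<le> b"
  shows "cmod (det A) \<le> fact m * b ^ m"
proof -
  have "cmod (det A) \<le> (\<Sum>p\<in>{p. p permutes {0..<m}}. cmod (signof p * (\<Prod>i=0..<m. A $$ (i, p i))))"
    unfolding det_def'[OF A] by (rule norm_sum)
  also have "\<dots> \<le> (\<Sum>p\<in>{p. p permutes {0..<m}}. b ^ m)"
  proof (rule sum_mono)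
    fix p assume "p \<in> {p. p permutes {0..<m}}"
    then have p: "p i < m" if "i < m" for i using that permutes_in_image[of p "{0..<m}" i] by simp
    have "cmod (signof p * (\<Prod>i=0..<m. A $$ (i, p i))) = (\<Prod>i=0..<m. cmod (A $$ (i, p i)))"
      by (simp add: norm_mult prod_norm sign_def)
    also have "\<dots> \<le> (\<Prod>i=0..<m. b)" using p b by (intro prod_mono) auto
    finally show "cmod (signof p * (\<Prod>i=0..<m. A $$ (i, p i))) \<le> b ^ m" by simp
  qed
  also have "\<dots> = fact m * b ^ m" by (simp add: card_permutations)
  finally show ?thesis .
qed

text \<open>The bound is linear in the squared entries of \<open>h\<close>, hence integrable for
  Gaussian \<open>h\<close>, and depends on \<open>Q\<close> only through the entry bound
  \<open>B\<close>. It results from the determinant bound for entries of size 1 + x followed by ln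
  (1 + x) \<le> x.\<close>

lemma logdet_le:
  assumes h: "h \<in> carrier_mat m n" and Q: "psd n Q" and a: "a \<ge> 0"
    and B: "\<And>k l. k < n \<Longrightarrow> l < n \<Longrightarrow> cmod (Q $$ (k,l)) \<le> B" and "B \<ge> 0"
  shows "logdet h a Q \<le> ln (fact m) + m * (2 * a * B * n * (\<Sum>i<m. \<Sum>k<n. (cmod (h $$ (i,k)))^2))"
proof -
  define S where "S = (\<Sum>i<m. \<Sum>k<n. (cmod (h $$ (i,k)))^2)"
  \<comment> \<open>The factor \<open>n\<close> counts the free summation index, and 2 is there
    because rows i and j of \<open>h\<close> contribute at most \<open>S\<close> each.\<close>
  define x where "x = 2 * a * B * n * S"
  define A where "A = 1\<^sub>m m + complex_of_real a \<cdot>\<^sub>m (h * Q * adj h)"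
  have Qc: "Q \<in> carrier_mat n n" using Q by (simp add: psd_def)
  have Ac: "A \<in> carrier_mat m m" unfolding A_def by (rule add_carrier_mat[OF smult_carrier_mat[OF congruence_carrier[OF h Qc]]])
  have S0: "S \<ge> 0" by (simp add: S_def sum_nonneg)
  have x0: "x \<ge> 0" using S0 a \<open>B \<ge> 0\<close> by (simp add: x_def)
  have row: "(\<Sum>k<n. (cmod (h $$ (i,k)))^2) \<le> S" if "i < m" for i
    unfolding S_def using that
    by (intro member_le_sum[of i "{..<m}" "\<lambda>i. \<Sum>k<n. (cmod (h $$ (i,k)))^2"]) (auto intro: sum_nonneg)
  have entry: "cmod (A $$ (i,j)) \<le> 1 + x" if ij: "i < m" "j < m" for i j
  proof -
    have "cmod ((h * Q * adj h) $$ (i,j)) \<le> (\<Sum>k<n. \<Sum>l<n. cmod (h $$ (i,k) * Q $$ (k,l) * cnj (h $$ (j,l))))"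
      unfolding congruence_index[OF h Qc ij]
      by (rule order_trans[OF norm_sum]) (intro sum_mono norm_sum)
    also have "\<dots> \<le> (\<Sum>k<n. \<Sum>l<n. B * ((cmod (h $$ (i,k)))^2 + (cmod (h $$ (j,l)))^2))"
    proof (intro sum_mono)
      fix k l assume "k \<in> {..<n}" "l \<in> {..<n}"
      then have "cmod (Q $$ (k,l)) \<le> B" using B by simp
      \<comment> \<open>This decouples row i from row j at the cost of a factor 1/2.\<close>
      moreover have "u * v \<le> u^2 + v^2" for u v :: real
      proof -
        have "0 \<le> (u - v)^2 + (u^2 + v^2)" by (intro add_nonneg_nonneg) auto
        also have "\<dots> = 2 * (u^2 + v^2 - u * v)" by (simp add: power2_eq_square algebra_simps)
        finally show ?thesis by simp
      qed
      ultimately have "cmod (Q $$ (k,l)) * (cmod (h $$ (i,k)) * cmod (h $$ (j,l)))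
          \<le> B * ((cmod (h $$ (i,k)))^2 + (cmod (h $$ (j,l)))^2)"
        using \<open>B \<ge> 0\<close> by (intro mult_mono) auto
      then show "cmod (h $$ (i,k) * Q $$ (k,l) * cnj (h $$ (j,l)))
          \<le> B * ((cmod (h $$ (i,k)))^2 + (cmod (h $$ (j,l)))^2)"
        by (simp add: norm_mult mult_ac)
    qed
    also have "\<dots> = B * n * ((\<Sum>k<n. (cmod (h $$ (i,k)))^2) + (\<Sum>l<n. (cmod (h $$ (j,l)))^2))"
      by (simp add: sum.distrib sum_distrib_left[symmetric] distrib_left)
    also have "\<dots> \<le> B * n * (S + S)"
      using row ij \<open>B \<ge> 0\<close> by (intro mult_left_mono add_mono) auto
    finally have "a * cmod ((h * Q * adj h) $$ (i,j)) \<le> a * (B * n * (S + S))"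
      using a by (rule mult_left_mono)
    also have "\<dots> = x" by (simp add: x_def algebra_simps)
    finally have "a * cmod ((h * Q * adj h) $$ (i,j)) \<le> x" .
    moreover have "A $$ (i,j) = (if i = j then 1 else 0) + complex_of_real a * (h * Q * adj h) $$ (i,j)"
      unfolding A_def one_plus_congruence_index[OF h Qc ij] congruence_index[OF h Qc ij] by (rule refl)
    then have "cmod (A $$ (i,j)) \<le> cmod (if i = j then 1 else 0) + cmod (complex_of_real a * (h * Q * adj h) $$ (i,j))"
      by (simp only: norm_triangle_ineq)
    then have "cmod (A $$ (i,j)) \<le> 1 + a * cmod ((h * Q * adj h) $$ (i,j))"
      using a by (auto simp: norm_mult split: if_splits simp del: index_mult_mat(1))
    ultimately show ?thesis by linarith
  qed
  have "1 \<le> Re (det A)" unfolding A_def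
    by (intro one_plus_psd_det_ge_1 psd_smult psd_congruence[OF h Q] a)
  moreover have "Re (det A) \<le> fact m * (1 + x) ^ m"
    using det_norm_le[OF Ac entry] complex_Re_le_cmod[of "det A"] by linarith
  ultimately have "ln (Re (det A)) \<le> ln (fact m * (1 + x) ^ m)" by (intro ln_mono) auto
  also have "\<dots> = ln (fact m) + m * ln (1 + x)"
    using x0 by (simp add: ln_mult_pos ln_realpow)
  also have "\<dots> \<le> ln (fact m) + m * x"
    using x0 by (intro add_left_mono mult_left_mono ln_add_one_self_le_self) auto
  finally show ?thesis using h by (simp add: logdet_def A_def x_def S_def)
qed

lemma det_tendsto:
  fixes A :: "nat \<Rightarrow> complex mat"
  assumes "\<And>r. A r \<in> carrier_mat m m" "B \<in> carrier_mat m m"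
    and "\<And>i j. i < m \<Longrightarrow> j < m \<Longrightarrow> (\<lambda>r. A r $$ (i,j)) \<longlonglongrightarrow> B $$ (i,j)"
  shows "(\<lambda>r. det (A r)) \<longlonglongrightarrow> det B"
  unfolding det_def'[OF assms(1)] det_def'[OF assms(2)]
proof (intro tendsto_intros)
  fix p i assume "p \<in> {p. p permutes {0..<m}}" "i \<in> {0..<m}"
  then show "(\<lambda>r. A r $$ (i, p i)) \<longlonglongrightarrow> B $$ (i, p i)"
    using assms(3)[of i "p i"] permutes_in_image[of p "{0..<m}" i] by simp
qed

lemma logdet_tendsto:
  assumes h: "h \<in> carrier_mat m n" and "\<And>r. Q r \<in> carrier_mat n n" "psd n R" "a \<ge> 0"
    and lim: "\<And>k l. k < n \<Longrightarrow> l < n \<Longrightarrow> (\<lambda>r. Q r $$ (k,l)) \<longlonglongrightarrow> R $$ (k,l)"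
  shows "(\<lambda>r. logdet h a (Q r)) \<longlonglongrightarrow> logdet h a R"
proof -
  have Rc: "R \<in> carrier_mat n n" using assms by (simp add: psd_def)
  \<comment> \<open>The limit stays away from 0, so \<open>ln\<close> is continuous there.\<close>
  have "1 \<le> Re (det (1\<^sub>m m + complex_of_real a \<cdot>\<^sub>m (h * R * adj h)))"
    by (intro one_plus_psd_det_ge_1 psd_smult psd_congruence[OF h] assms)
  moreover have "(\<lambda>r. det (1\<^sub>m m + complex_of_real a \<cdot>\<^sub>m (h * Q r * adj h)))
     \<longlonglongrightarrow> det (1\<^sub>m m + complex_of_real a \<cdot>\<^sub>m (h * R * adj h))"
  proof (rule det_tendsto)
    fix i j assume ij: "i < m" "j < m"
    show "(\<lambda>r. (1\<^sub>m m + complex_of_real a \<cdot>\<^sub>m (h * Q r * adj h)) $$ (i,j))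
        \<longlonglongrightarrow> (1\<^sub>m m + complex_of_real a \<cdot>\<^sub>m (h * R * adj h)) $$ (i,j)"
      unfolding one_plus_congruence_index[OF h assms(2) ij] one_plus_congruence_index[OF h Rc ij]
      by (intro tendsto_intros lim) auto
  qed (intro add_carrier_mat smult_carrier_mat congruence_carrier[OF h] assms(2) Rc)+
  ultimately show ?thesis
    using h unfolding logdet_def by (auto intro!: tendsto_ln tendsto_Re)
qed

lemma Hmat_carrier [simp]: "Hmat M N H \<omega> \<in> carrier_mat M N"
  by (simp add: Hmat_def)

lemma Hmat_index [simp]: "i < M \<Longrightarrow> j < N \<Longrightarrow> Hmat M N H \<omega> $$ (i,j) = H \<omega> i j"
  by (simp add: Hmat_def)

lemma capacity_eq_logdet:
  "capacity \<Omega> M N H \<sigma>2 Q = (LINT \<omega>|\<Omega>. logdet (Hmat M N H \<omega>) (1/\<sigma>2) Q)"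
  by (simp add: capacity_def logdet_def Hmat_def)

lemma borel_measurable_cnj: "cnj \<in> borel_measurable borel"
  by (intro borel_measurable_continuous_onI continuous_intros)

lemma logdet_measurable:
  assumes H: "\<And>i j. i < M \<Longrightarrow> j < N \<Longrightarrow> (\<lambda>\<omega>. H \<omega> i j) \<in> borel_measurable \<Omega>"
    and Q: "Q \<in> carrier_mat N N"
  shows "(\<lambda>\<omega>. logdet (Hmat M N H \<omega>) a Q) \<in> borel_measurable \<Omega>"
proof -
  define X where "X \<omega> = 1\<^sub>m M + complex_of_real a \<cdot>\<^sub>m (Hmat M N H \<omega> * Q * adj (Hmat M N H \<omega>))" for \<omega>
  have Xc: "X \<omega> \<in> carrier_mat M M" for \<omega>
    unfolding X_def using congruence_carrier[OF Hmat_carrier Q]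
    by (intro add_carrier_mat smult_carrier_mat)
  have eq: "X \<omega> $$ (i,j) = (if i = j then 1 else 0)
      + complex_of_real a * (\<Sum>k<N. \<Sum>l<N. H \<omega> i k * Q $$ (k,l) * cnj (H \<omega> j l))"
    if "i < M" "j < M" for \<omega> i j
    using that by (simp only: X_def one_plus_congruence_index[OF Hmat_carrier Q that])
      (intro arg_cong2[where f = plus] arg_cong2[where f = times] sum.cong refl; simp)
  have meas: "(\<lambda>\<omega>. (if i = j then 1 else 0)
      + complex_of_real a * (\<Sum>k<N. \<Sum>l<N. H \<omega> i k * Q $$ (k,l) * cnj (H \<omega> j l))) \<in> borel_measurable \<Omega>"
    if "i < M" "j < M" for i j
  proof -
    have "(\<lambda>\<omega>. cnj (H \<omega> j l)) \<in> borel_measurable \<Omega>" if "l < N" for l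
      using measurable_compose[OF H[OF \<open>j < M\<close> that] borel_measurable_cnj] .
    then have "(\<lambda>\<omega>. H \<omega> i k * Q $$ (k,l) * cnj (H \<omega> j l)) \<in> borel_measurable \<Omega>"
      if "k < N" "l < N" for k l
      using borel_measurable_times[OF borel_measurable_times[OF H[OF \<open>i < M\<close>] borel_measurable_const]]
        that by metis
    then have "(\<lambda>\<omega>. \<Sum>k<N. \<Sum>l<N. H \<omega> i k * Q $$ (k,l) * cnj (H \<omega> j l)) \<in> borel_measurable \<Omega>"
      by (intro borel_measurable_sum) auto
    then show ?thesis by measurable
  qed
  have ent: "(\<lambda>\<omega>. X \<omega> $$ (i,j)) \<in> borel_measurable \<Omega>" if "i < M" "j < M" for i j
    unfolding eq[OF that] by (rule meas[OF that])
  have "(\<lambda>\<omega>. det (X \<omega>)) \<in> borel_measurable \<Omega>"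
    unfolding det_def'[OF Xc]
  proof (intro borel_measurable_sum borel_measurable_times borel_measurable_prod borel_measurable_const ent)
    fix p i assume "p \<in> {p. p permutes {0..<M}}" "i \<in> {0..<M}"
    then show "i < M" "p i < M" using permutes_in_image[of p "{0..<M}" i] by auto
  qed
  then have "(\<lambda>\<omega>. ln (Re (det (X \<omega>)))) \<in> borel_measurable \<Omega>" by measurable
  then show ?thesis by (simp add: logdet_def X_def Hmat_def)
qed

section \<open>Existence of a maximizer\<close>

lemma sum_pair_delta:
  fixes f :: "nat \<Rightarrow> nat \<Rightarrow> 'b::semiring_1"
  assumes "i < M" "j < N"
  shows "(\<Sum>i'<M. \<Sum>j'<N. (if i' = i \<and> j' = j then c else 0) * f i' j') = c * f i j"
    and "(\<Sum>i'<M. \<Sum>j'<N. f i' j' * (if i' = i \<and> j' = j then c else 0)) = f i j * c"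
proof -
  have "(\<Sum>j'<N. (if i' = i \<and> j' = j then c else 0) * f i' j') = (if i' = i then c * f i j else 0)" for i'
  proof -
    have "(if i' = i \<and> j' = j then c else 0) * f i' j' = (if j' = j then (if i' = i then c * f i j else 0) else 0)" for j'
      by auto
    then show ?thesis using assms by simp
  qed
  then show "(\<Sum>i'<M. \<Sum>j'<N. (if i' = i \<and> j' = j then c else 0) * f i' j') = c * f i j"
    using assms by simp
  have "(\<Sum>j'<N. f i' j' * (if i' = i \<and> j' = j then c else 0)) = (if i' = i then f i j * c else 0)" for i'
  proof -
    have "f i' j' * (if i' = i \<and> j' = j then c else 0) = (if j' = j then (if i' = i then f i j * c else 0) else 0)" for j'
      by auto
    then show ?thesis using assms by simp
  qed
  then show "(\<Sum>i'<M. \<Sum>j'<N. f i' j' * (if i' = i \<and> j' = j then c else 0)) = f i j * c"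
    using assms by simp
qed

text \<open>A test family supported at the single index (i,j) with value z yields the characteristic
  function of Re (conj(z) H_ij). Real and imaginary z give the real and the imaginary part of the
  entry, both with parameter \<open>Re S / 4\<close>.\<close>

lemma cgauss_square_integrable:
  assumes g: "cgauss \<Omega> M N H \<Sigma>" and ij: "i < M" "j < N"
  shows "integrable \<Omega> (\<lambda>\<omega>. (cmod (H \<omega> i j))^2)"
proof -
  interpret prob_space \<Omega> using g by (simp add: cgauss_def)
  have [measurable]: "(\<lambda>\<omega>. H \<omega> i j) \<in> borel_measurable \<Omega>" using g ij by (simp add: cgauss_def)
  define S where "S = \<Sigma> $$ (i*N+j, i*N+j)"
  have char: "(LINT \<omega>|\<Omega>. cis (Re (cnj z * H \<omega> i j))) = complex_of_real (exp (- Re (cnj z * S * z) / 4))" for z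
  proof -
    define t where "t = (\<lambda>i' j'. if i' = i \<and> j' = j then z else 0)"
    have cnj_t: "cnj (t i' j') = (if i' = i \<and> j' = j then cnj z else 0)" for i' j'
      by (simp add: t_def)
    have lin: "(\<Sum>i'<M. \<Sum>j'<N. cnj (t i' j') * H \<omega> i' j') = cnj z * H \<omega> i j" for \<omega>
      unfolding cnj_t by (rule sum_pair_delta(1)[OF ij])
    have quad: "(\<Sum>i'<M. \<Sum>j'<N. \<Sum>l<M. \<Sum>m<N. cnj (t i' j') * \<Sigma> $$ (i'*N+j', l*N+m) * t l m) = cnj z * S * z"
    proof -
      have "(\<Sum>l<M. \<Sum>m<N. cnj (t i' j') * \<Sigma> $$ (i'*N+j', l*N+m) * t l m)
          = cnj (t i' j') * (\<Sigma> $$ (i'*N+j', i*N+j) * z)" for i' j'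
        unfolding t_def by (rule trans[OF sum_pair_delta(2)[OF ij] mult.assoc])
      then show ?thesis unfolding cnj_t S_def
        by (simp only: sum_pair_delta(1)[OF ij] mult.assoc)
    qed
    show ?thesis using g unfolding cgauss_def by (metis (no_types, lifting) lin quad Bochner_Integration.integral_cong)
  qed
  have "integrable \<Omega> (\<lambda>\<omega>. (Re (H \<omega> i j))^2)"
  proof (rule char_quadratic_imp_square_integrable[where v = "Re S / 4"])
    show "(LINT \<omega>|\<Omega>. cis (t * Re (H \<omega> i j))) = complex_of_real (exp (- (Re S / 4 * t^2)))" for t
      using char[of "complex_of_real t"] by (simp add: power2_eq_square mult_ac)
  qed measurable
  moreover have "integrable \<Omega> (\<lambda>\<omega>. (Im (H \<omega> i j))^2)"
  proof (rule char_quadratic_imp_square_integrable[where v = "Re S / 4"])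
    show "(LINT \<omega>|\<Omega>. cis (t * Im (H \<omega> i j))) = complex_of_real (exp (- (Re S / 4 * t^2)))" for t
      using char[of "\<i> * complex_of_real t"] by (simp add: power2_eq_square mult_ac)
  qed measurable
  ultimately show ?thesis by (simp add: cmod_power2)
qed

text \<open>One integrable majorant for all feasible \<open>Q\<close> at once: it bounds the
  capacity from above and it serves dominated convergence along a maximizing sequence. The
  \<open>2 * p\<close> is the bound of \<open>psd_entry_le_trace\<close>.\<close>

lemma logdet_dominated:
  assumes g: "cgauss \<Omega> M N H \<Sigma>" and "a \<ge> 0" "p \<ge> 0"
  obtains G where "integrable \<Omega> G"
    "\<And>Q \<omega>. psd N Q \<Longrightarrow> Re (mtrace Q) \<le> p \<Longrightarrow> logdet (Hmat M N H \<omega>) a Q \<le> G \<omega>"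
proof -
  interpret prob_space \<Omega> using g by (simp add: cgauss_def)
  define G where "G \<omega> = ln (fact M) + M * (2 * a * (2 * p) * N * (\<Sum>i<M. \<Sum>k<N. (cmod (H \<omega> i k))^2))" for \<omega>
  have "integrable \<Omega> G"
    unfolding G_def
    by (intro Bochner_Integration.integrable_add integrable_const integrable_mult_right
        Bochner_Integration.integrable_sum cgauss_square_integrable[OF g]) auto
  moreover have "logdet (Hmat M N H \<omega>) a Q \<le> G \<omega>" if "psd N Q" "Re (mtrace Q) \<le> p" for Q \<omega>
  proof -
    have "logdet (Hmat M N H \<omega>) a Q
      \<le> ln (fact M) + M * (2 * a * (2 * p) * N * (\<Sum>i<M. \<Sum>k<N. (cmod (Hmat M N H \<omega> $$ (i,k)))^2))"
      using psd_entry_le_trace[OF that(1)] that \<open>p \<ge> 0\<close>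
      by (intro logdet_le[OF Hmat_carrier that(1) \<open>a \<ge> 0\<close>]) force+
    then show ?thesis by (simp add: G_def)
  qed
  ultimately show ?thesis using that by blast
qed

lemma psd_trace_nonneg: "psd n Q \<Longrightarrow> Re (mtrace Q) \<ge> 0"
  using psd_diag[of n Q] by (auto simp: mtrace_def psd_def intro!: sum_nonneg)

lemma cgauss_logdet_measurable:
  assumes "cgauss \<Omega> M N H \<Sigma>" "psd N Q"
  shows "(\<lambda>\<omega>. logdet (Hmat M N H \<omega>) a Q) \<in> borel_measurable \<Omega>"
  using assms by (intro logdet_measurable) (auto simp: cgauss_def psd_def)

lemma logdet_integrable:
  assumes g: "cgauss \<Omega> M N H \<Sigma>" and Q: "psd N Q" and "a \<ge> 0"
  shows "integrable \<Omega> (\<lambda>\<omega>. logdet (Hmat M N H \<omega>) a Q)"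
proof -
  obtain G where G: "integrable \<Omega> G" "\<And>\<omega>. logdet (Hmat M N H \<omega>) a Q \<le> G \<omega>"
    using logdet_dominated[OF g \<open>a \<ge> 0\<close> psd_trace_nonneg[OF Q]] Q by (metis order_refl)
  show ?thesis
  proof (rule Bochner_Integration.integrable_bound[OF G(1)])
    show "AE \<omega> in \<Omega>. norm (logdet (Hmat M N H \<omega>) a Q) \<le> norm (G \<omega>)"
    proof (rule AE_I2)
      fix \<omega>
      show "norm (logdet (Hmat M N H \<omega>) a Q) \<le> norm (G \<omega>)"
        using G(2)[of \<omega>] logdet_nonneg[OF Hmat_carrier Q \<open>a \<ge> 0\<close>, of M H \<omega>]
        unfolding real_norm_def by linarith
    qed
  qed (rule cgauss_logdet_measurable[OF g Q])
qed

lemma capacity_midpoint: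
  assumes g: "cgauss \<Omega> M N H \<Sigma>" and A: "psd N A" and B: "psd N B" and "\<sigma>2 > 0"
  shows "(capacity \<Omega> M N H \<sigma>2 A + capacity \<Omega> M N H \<sigma>2 B) / 2
    \<le> capacity \<Omega> M N H \<sigma>2 ((1/2) \<cdot>\<^sub>m (A + B))"
proof -
  have a: "1/\<sigma>2 \<ge> 0" using \<open>\<sigma>2 > 0\<close> by simp
  note int = logdet_integrable[OF g _ a]
  have C: "psd N ((1/2) \<cdot>\<^sub>m (A + B))" using psd_smult[OF psd_add[OF A B], of "1/2"] by simp
  have "(LINT \<omega>|\<Omega>. (logdet (Hmat M N H \<omega>) (1/\<sigma>2) A + logdet (Hmat M N H \<omega>) (1/\<sigma>2) B) / 2)
      \<le> (LINT \<omega>|\<Omega>. logdet (Hmat M N H \<omega>) (1/\<sigma>2) ((1/2) \<cdot>\<^sub>m (A + B)))"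
    by (rule integral_mono[OF _ int[OF C] logdet_midpoint[OF Hmat_carrier A B a]])
      (intro integrable_divide Bochner_Integration.integrable_add int A B)
  then show ?thesis using int[OF A] int[OF B] by (simp add: capacity_eq_logdet)
qed

text \<open>Bolzano-Weierstrass, one index at a time, each refining the previous subsequence.
  Applied to matrix entries it supplies the compactness of the feasible set.\<close>

lemma bounded_family_convergent_subseq:
  fixes f :: "nat \<Rightarrow> 'i \<Rightarrow> complex"
  assumes "finite I" "\<And>r i. i \<in> I \<Longrightarrow> cmod (f r i) \<le> B"
  shows "\<exists>L s. strict_mono s \<and> (\<forall>i\<in>I. (\<lambda>r. f (s r) i) \<longlonglongrightarrow> L i)"
  using assms
proof (induction I)
  case empty
  then show ?case using strict_mono_id by auto
next
  case (insert k I)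
  then obtain L s where s: "strict_mono (s :: nat \<Rightarrow> nat)" "\<forall>i\<in>I. (\<lambda>r. f (s r) i) \<longlonglongrightarrow> L i"
    by auto
  have "bounded (range (\<lambda>r. f (s r) k))"
    using insert.prems by (auto simp: bounded_iff)
  then obtain l s' where s': "strict_mono (s' :: nat \<Rightarrow> nat)" "((\<lambda>r. f (s r) k) \<circ> s') \<longlonglongrightarrow> l"
    using bounded_imp_convergent_subsequence by blast
  have "(\<lambda>r. f ((s \<circ> s') r) i) \<longlonglongrightarrow> (L(k := l)) i" if "i \<in> insert k I" for i
  proof (cases "i = k")
    case True
    then show ?thesis using s'(2) by (simp add: comp_def)
  next
    case False
    then have "(\<lambda>r. f (s r) i) \<longlonglongrightarrow> L i" using that s(2) by blast
    from LIMSEQ_subseq_LIMSEQ[OF this s'(1)] show ?thesis using False by (simp add: comp_def)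
  qed
  moreover have "strict_mono (s \<circ> s')" using s(1) s'(1) by (rule strict_mono_o)
  ultimately show ?case by blast
qed

lemma psd_limit:
  assumes Q: "\<And>r. psd n (Q r)" and R: "R \<in> carrier_mat n n"
    and lim: "\<And>k l. k < n \<Longrightarrow> l < n \<Longrightarrow> (\<lambda>r. Q r $$ (k,l)) \<longlonglongrightarrow> R $$ (k,l)"
  shows "psd n R"
  unfolding psd_iff_qform
proof (intro conjI allI R)
  fix v
  have q: "(\<lambda>r. qform n (Q r) v) \<longlonglongrightarrow> qform n R v"
    unfolding qform_def by (intro tendsto_intros lim) auto
  have "(\<lambda>r. Im (qform n (Q r) v)) = (\<lambda>r. 0)" using Q by (auto simp: psd_iff_qform)
  then show "Im (qform n R v) = 0" using tendsto_Im[OF q] by (simp add: LIMSEQ_const_iff)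
  show "Re (qform n R v) \<ge> 0"
    using tendsto_Re[OF q] Q by (intro LIMSEQ_le_const[of _ _ 0]) (auto simp: psd_iff_qform)
qed

lemma capacity_attained:
  assumes g: "cgauss \<Omega> M N H \<Sigma>" and "\<sigma>2 > 0" "p \<ge> 0"
  shows "\<exists>Q. psd N Q \<and> Re (mtrace Q) \<le> p \<and>
     (\<forall>Q'. psd N Q' \<and> Re (mtrace Q') \<le> p \<longrightarrow> capacity \<Omega> M N H \<sigma>2 Q' \<le> capacity \<Omega> M N H \<sigma>2 Q)"
proof -
  define D where "D = {Q. psd N Q \<and> Re (mtrace Q) \<le> p}"
  define C where "C = capacity \<Omega> M N H \<sigma>2"
  have a: "1/\<sigma>2 \<ge> 0" using \<open>\<sigma>2 > 0\<close> by simp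
  obtain G where G: "integrable \<Omega> G"
    "\<And>Q \<omega>. psd N Q \<Longrightarrow> Re (mtrace Q) \<le> p \<Longrightarrow> logdet (Hmat M N H \<omega>) (1/\<sigma>2) Q \<le> G \<omega>"
    using logdet_dominated[OF g a \<open>p \<ge> 0\<close>] by metis
  have le: "C Q \<le> integral\<^sup>L \<Omega> G" if "Q \<in> D" for Q
    using that G logdet_integrable[OF g _ a, of Q]
    by (auto simp: C_def D_def capacity_eq_logdet intro!: integral_mono)
  then have bdd: "bdd_above (C ` D)" by (auto intro!: bdd_aboveI)
  have "0\<^sub>m N N \<in> D" using psd_zero \<open>p \<ge> 0\<close> by (simp add: D_def mtrace_def)
  then have ne: "C ` D \<noteq> {}" by auto
  \<comment> \<open>The zero matrix is feasible and the integral of \<open>G\<close> bounds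
    \<open>C\<close> on \<open>D\<close>, so the supremum is a genuine real number and has a
    maximizing sequence.\<close>
  have "\<exists>Q\<in>D. Sup (C ` D) - 1 / real (Suc r) < C Q" for r
    using less_cSup_iff[OF ne bdd, of "Sup (C ` D) - 1 / real (Suc r)"] by auto
  then obtain Q where Q: "\<And>r. Q r \<in> D" "\<And>r. Sup (C ` D) - 1 / real (Suc r) < C (Q r)" by metis
  have "cmod (Q r $$ kl) \<le> 2 * p" if "kl \<in> {..<N} \<times> {..<N}" for r kl
    using Q(1)[of r] that psd_entry_le_trace[of N "Q r" "fst kl" "snd kl"] by (force simp: D_def)
  then obtain L s where s: "strict_mono (s :: nat \<Rightarrow> nat)"
      "\<forall>kl\<in>{..<N} \<times> {..<N}. (\<lambda>r. Q (s r) $$ kl) \<longlonglongrightarrow> L kl"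
    using bounded_family_convergent_subseq[of "{..<N} \<times> {..<N}" "\<lambda>r kl. Q r $$ kl" "2 * p"] by auto
  define R where "R = mat N N L"
  have Rc: "R \<in> carrier_mat N N" by (simp add: R_def)
  have lim: "(\<lambda>r. Q (s r) $$ (k,l)) \<longlonglongrightarrow> R $$ (k,l)" if "k < N" "l < N" for k l
    using that s(2) by (simp add: R_def)
  have Qpsd: "psd N (Q r)" "Re (mtrace (Q r)) \<le> p" "Q r \<in> carrier_mat N N" for r
    using Q(1)[of r] by (auto simp: D_def psd_def)
  have Rpsd: "psd N R" using psd_limit[OF Qpsd(1) Rc lim] .
  have tr: "(\<lambda>r. mtrace (Q (s r))) \<longlonglongrightarrow> mtrace R"
  proof -
    have "mtrace X = (\<Sum>i<N. X $$ (i,i))" if "X \<in> carrier_mat N N" for X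
      using that by (simp add: mtrace_def)
    note e = this
    show ?thesis unfolding e[OF Qpsd(3)] e[OF Rc] by (intro tendsto_sum lim) auto
  qed
  have "Re (mtrace R) \<le> p"
    using tendsto_Re[OF tr] Qpsd(2) by (intro LIMSEQ_le_const2[of _ _ p]) auto
  then have "R \<in> D" using Rpsd by (simp add: D_def)
  have "(\<lambda>r. C (Q (s r))) \<longlonglongrightarrow> C R"
    unfolding C_def capacity_eq_logdet
  proof (rule integral_dominated_convergence[OF _ _ G(1)])
    show "AE \<omega> in \<Omega>. (\<lambda>r. logdet (Hmat M N H \<omega>) (1/\<sigma>2) (Q (s r))) \<longlonglongrightarrow> logdet (Hmat M N H \<omega>) (1/\<sigma>2) R"
      by (intro AE_I2 logdet_tendsto[OF Hmat_carrier Qpsd(3) Rpsd a lim])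
    show "AE \<omega> in \<Omega>. norm (logdet (Hmat M N H \<omega>) (1/\<sigma>2) (Q (s r))) \<le> G \<omega>" for r
    proof (rule AE_I2)
      fix \<omega>
      show "norm (logdet (Hmat M N H \<omega>) (1/\<sigma>2) (Q (s r))) \<le> G \<omega>"
        using G(2)[OF Qpsd(1,2)[of "s r"], of \<omega>]
          logdet_nonneg[OF Hmat_carrier Qpsd(1)[of "s r"] a, of M H \<omega>]
        unfolding real_norm_def by linarith
    qed
  qed (intro cgauss_logdet_measurable[OF g] Rpsd Qpsd)+
  moreover have "(\<lambda>r. Sup (C ` D) - 1 / real (Suc (s r))) \<longlonglongrightarrow> Sup (C ` D) - 0"
    using LIMSEQ_subseq_LIMSEQ[OF LIMSEQ_Suc[OF lim_const_over_n[of 1]] s(1)]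
    by (intro tendsto_diff tendsto_const) (simp add: comp_def)
  ultimately have "Sup (C ` D) \<le> C R"
    using Q(2) by (intro LIMSEQ_le) (auto intro!: exI[of _ 0] less_imp_le)
  then have "C Q' \<le> C R" if "Q' \<in> D" for Q'
    using cSup_upper[OF imageI[OF that] bdd] by linarith
  then show ?thesis using \<open>R \<in> D\<close> by (auto simp: D_def C_def)
qed

section \<open>Symmetries and pinching\<close>

lemma sum_index_split:
  fixes f :: "nat \<Rightarrow> 'b::comm_monoid_add"
  shows "(\<Sum>r<M*N. f r) = (\<Sum>l<M. \<Sum>m<N. f (l*N+m))"
  by (simp add: sum.nat_group[symmetric] sum.atLeastLessThan_shift_0 atLeast0LessThan)

lemma index_split_less: "l < M \<Longrightarrow> m < N \<Longrightarrow> l*N+m < M*(N::nat)"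
  by (metis Suc_leI add_less_cancel_left less_le_trans mult_Suc mult_le_mono1 add.commute)

text \<open>The matrix \<open>kron (1\<^sub>m M) A\<close> is block diagonal with \<open>A\<close>
  repeated, so commuting with \<open>S\<close> means that \<open>A\<close> commutes with each N x N
  block of \<open>S\<close> separately.\<close>

lemma right_commutant_block:
  assumes A: "A \<in> right_commutant M N S" and S: "S \<in> carrier_mat (M*N) (M*N)"
    and il: "i < M" "l < M" and jm: "j < N" "m < N"
  shows "(\<Sum>k<N. A $$ (j,k) * S $$ (i*N+k, l*N+m)) = (\<Sum>k<N. S $$ (i*N+j, l*N+k) * A $$ (k,m))"
proof -
  have Ac: "A \<in> carrier_mat N N" and comm: "kron (1\<^sub>m M) A * S = S * kron (1\<^sub>m M) A"
    using A by (auto simp: right_commutant_def)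
  have Kc: "kron (1\<^sub>m M) A \<in> carrier_mat (M*N) (M*N)" using Ac by (simp add: kron_def)
  have K: "kron (1\<^sub>m M) A $$ (x*N+y, x'*N+y') = (if x = x' then A $$ (y,y') else 0)"
    if "x < M" "y < N" "x' < M" "y' < N" for x y x' y'
    using that Ac index_split_less[of x M y N] index_split_less[of x' M y' N] by (auto simp: kron_def)
  have "(kron (1\<^sub>m M) A * S) $$ (i*N+j, l*N+m)
      = (\<Sum>x<M. \<Sum>k<N. kron (1\<^sub>m M) A $$ (i*N+j, x*N+k) * S $$ (x*N+k, l*N+m))"
    unfolding mult_mat_index_sum[OF Kc S index_split_less[OF il(1) jm(1)] index_split_less[OF il(2) jm(2)]]
    by (rule sum_index_split)
  also have "\<dots> = (\<Sum>x<M. if x = i then \<Sum>k<N. A $$ (j,k) * S $$ (i*N+k, l*N+m) else 0)"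
    using il jm by (intro sum.cong refl) (auto simp: K)
  also have "\<dots> = (\<Sum>k<N. A $$ (j,k) * S $$ (i*N+k, l*N+m))" using il by simp
  finally have 1: "(kron (1\<^sub>m M) A * S) $$ (i*N+j, l*N+m) = (\<Sum>k<N. A $$ (j,k) * S $$ (i*N+k, l*N+m))" .
  have "(S * kron (1\<^sub>m M) A) $$ (i*N+j, l*N+m)
      = (\<Sum>x<M. \<Sum>k<N. S $$ (i*N+j, x*N+k) * kron (1\<^sub>m M) A $$ (x*N+k, l*N+m))"
    unfolding mult_mat_index_sum[OF S Kc index_split_less[OF il(1) jm(1)] index_split_less[OF il(2) jm(2)]]
    by (rule sum_index_split)
  also have "\<dots> = (\<Sum>x<M. if x = l then \<Sum>k<N. S $$ (i*N+j, l*N+k) * A $$ (k,m) else 0)"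
    using il jm by (intro sum.cong refl) (auto simp: K)
  also have "\<dots> = (\<Sum>k<N. S $$ (i*N+j, l*N+k) * A $$ (k,m))" using il by simp
  finally show ?thesis using 1 comm by simp
qed

text \<open>In matrix notation the left side is x^t w^t s w^t y. The first hypothesis says w^t s = s
  w^t, which brings the two copies of w^t together, and the second cancels them.\<close>

lemma block_form_invariant:
  fixes w s :: "nat \<Rightarrow> nat \<Rightarrow> complex"
  assumes comm: "\<And>j m. j < N \<Longrightarrow> m < N \<Longrightarrow> (\<Sum>k<N. w k j * s k m) = (\<Sum>k<N. s j k * w m k)"
    and invol: "\<And>j m. j < N \<Longrightarrow> m < N \<Longrightarrow> (\<Sum>k<N. w j k * w k m) = (if j = m then 1 else 0)"
  shows "(\<Sum>j<N. \<Sum>m<N. (\<Sum>j'<N. x j' * w j j') * s j m * (\<Sum>m'<N. y m' * w m' m))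
       = (\<Sum>j<N. \<Sum>m<N. x j * s j m * y m)"
proof -
  have "(\<Sum>j<N. (\<Sum>j'<N. x j' * w j j') * s j m) = (\<Sum>k<N. (\<Sum>j<N. x j * s j k) * w m k)"
    if "m < N" for m
  proof -
    have "(\<Sum>j<N. (\<Sum>j'<N. x j' * w j j') * s j m) = (\<Sum>j<N. \<Sum>j'<N. x j' * (w j j' * s j m))"
      by (simp add: sum_distrib_right mult.assoc)
    also have "\<dots> = (\<Sum>j'<N. \<Sum>j<N. x j' * (w j j' * s j m))" by (rule sum.swap)
    also have "\<dots> = (\<Sum>j'<N. x j' * (\<Sum>k<N. s j' k * w m k))"
      using comm that by (simp add: sum_distrib_left[symmetric])
    also have "\<dots> = (\<Sum>j'<N. \<Sum>k<N. x j' * s j' k * w m k)"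
      by (simp add: sum_distrib_left mult.assoc)
    also have "\<dots> = (\<Sum>k<N. \<Sum>j'<N. x j' * s j' k * w m k)" by (rule sum.swap)
    finally show ?thesis by (simp add: sum_distrib_right)
  qed
  note inner = this
  have "(\<Sum>j<N. \<Sum>m<N. (\<Sum>j'<N. x j' * w j j') * s j m * (\<Sum>m'<N. y m' * w m' m))
      = (\<Sum>m<N. (\<Sum>j<N. (\<Sum>j'<N. x j' * w j j') * s j m) * (\<Sum>m'<N. y m' * w m' m))"
    by (subst sum.swap) (simp only: sum_distrib_right)
  also have "\<dots> = (\<Sum>m<N. (\<Sum>k<N. (\<Sum>j<N. x j * s j k) * w m k) * (\<Sum>m'<N. y m' * w m' m))"
    using inner by (intro sum.cong refl) simp
  also have "\<dots> = (\<Sum>m<N. \<Sum>k<N. \<Sum>m'<N. (\<Sum>j<N. x j * s j k) * y m' * (w m' m * w m k))"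
    unfolding sum_product by (intro sum.cong refl) (simp add: mult_ac)
  also have "\<dots> = (\<Sum>k<N. \<Sum>m<N. \<Sum>m'<N. (\<Sum>j<N. x j * s j k) * y m' * (w m' m * w m k))"
    by (rule sum.swap)
  also have "\<dots> = (\<Sum>k<N. \<Sum>m'<N. \<Sum>m<N. (\<Sum>j<N. x j * s j k) * y m' * (w m' m * w m k))"
    by (intro sum.cong refl sum.swap)
  also have "\<dots> = (\<Sum>k<N. \<Sum>m'<N. (\<Sum>j<N. x j * s j k) * y m' * (if m' = k then 1 else 0))"
    using invol by (intro sum.cong refl) (simp add: sum_distrib_left[symmetric])
  also have "\<dots> = (\<Sum>k<N. (\<Sum>j<N. x j * s j k) * y k)"
  proof (intro sum.cong refl)
    fix k assume "k \<in> {..<N}"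
    have "(\<Sum>m'<N. (\<Sum>j<N. x j * s j k) * y m' * (if m' = k then 1 else 0))
        = (\<Sum>m'<N. if m' = k then (\<Sum>j<N. x j * s j k) * y k else 0)"
      by (intro sum.cong) auto
    then show "(\<Sum>m'<N. (\<Sum>j<N. x j * s j k) * y m' * (if m' = k then 1 else 0)) = (\<Sum>j<N. x j * s j k) * y k"
      using \<open>k \<in> {..<N}\<close> by simp
  qed
  also have "\<dots> = (\<Sum>j<N. \<Sum>m<N. x j * s j m * y m)"
    by (subst sum.swap) (simp only: sum_distrib_right)
  finally show ?thesis .
qed

text \<open>\<open>H\<close> is replaced by \<open>H W\<close>. The assumption on \<open>W\<close>
  says that W^t commutes with every block of the covariance, so the characteristic function, and
  hence the law, stays the same; on the other hand \<open>adj W = W\<close> moves the two factors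
  from the channel onto \<open>Q\<close>.\<close>

lemma capacity_congruence_invariant:
  assumes g: "cgauss \<Omega> M N H \<Sigma>" and W: "W \<in> carrier_mat N N" and herm: "adj W = W"
    and invol: "W * W = 1\<^sub>m N"
    and comm: "\<And>i l j m. i < M \<Longrightarrow> l < M \<Longrightarrow> j < N \<Longrightarrow> m < N \<Longrightarrow>
      (\<Sum>k<N. W $$ (k,j) * \<Sigma> $$ (i*N+k, l*N+m)) = (\<Sum>k<N. \<Sigma> $$ (i*N+j, l*N+k) * W $$ (m,k))"
    and Q: "Q \<in> carrier_mat N N"
  shows "capacity \<Omega> M N H \<sigma>2 (W * Q * W) = capacity \<Omega> M N H \<sigma>2 Q"
proof -
  interpret prob_space \<Omega> using g by (simp add: cgauss_def)
  define H' where "H' \<omega> i j = (\<Sum>k<N. H \<omega> i k * W $$ (k,j))" for \<omega> i j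
  \<comment> \<open>The uniqueness theorem concerns real coordinates: \<open>co\<close> takes
    complex entries apart into real and imaginary parts, \<open>as\<close> reassembles them, and
    \<open>f\<close> is the integrand as a function of the coordinates.\<close>
  define I where "I = {..<M} \<times> {..<N} \<times> (UNIV :: bool set)"
  define co where "co h = (\<lambda>(i, j, b). if b then Re (h i j) else Im (h i j))"
    for h :: "nat \<Rightarrow> nat \<Rightarrow> complex"
  define as where "as x i j = Complex (x (i, j, True)) (x (i, j, False))"
    for x :: "nat \<times> nat \<times> bool \<Rightarrow> real" and i j
  define f where "f x = logdet (Hmat M N as x) (1/\<sigma>2) Q" for x
  have Hm: "(\<lambda>\<omega>. H \<omega> i j) \<in> borel_measurable \<Omega>" if "i < M" "j < N" for i j
    using g that by (simp add: cgauss_def)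
  have H'm: "(\<lambda>\<omega>. H' \<omega> i j) \<in> borel_measurable \<Omega>" if "i < M" for i j
    unfolding H'_def using Hm[OF that]
    by (intro borel_measurable_sum borel_measurable_times borel_measurable_const) auto
  have com: "(\<lambda>\<omega>. co (K \<omega>) ijb) \<in> borel_measurable \<Omega>"
    if "\<And>i j. i < M \<Longrightarrow> j < N \<Longrightarrow> (\<lambda>\<omega>. K \<omega> i j) \<in> borel_measurable \<Omega>" and "ijb \<in> I" for K ijb
  proof -
    obtain i j b where ijb: "ijb = (i, j, b)" "i < M" "j < N" using \<open>ijb \<in> I\<close> by (auto simp: I_def)
    have [measurable]: "(\<lambda>\<omega>. K \<omega> i j) \<in> borel_measurable \<Omega>" using that(1) ijb by simp
    show ?thesis unfolding ijb co_def by (cases b) simp_all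
  qed
  have asm: "(\<lambda>x. as x i j) \<in> borel_measurable (PiM I (\<lambda>_. borel))" if "i < M" "j < N" for i j
  proof -
    have [measurable]: "(\<lambda>x. x (i, j, b)) \<in> borel_measurable (PiM I (\<lambda>_. borel :: real measure))" for b
      using that by (intro measurable_component_singleton) (simp add: I_def)
    have "as x i j = complex_of_real (x (i, j, True)) + \<i> * complex_of_real (x (i, j, False))" for x
      by (simp add: as_def Complex_eq)
    then show ?thesis by simp
  qed
  have fm: "f \<in> borel_measurable (PiM I (\<lambda>_. borel))"
    unfolding f_def by (rule logdet_measurable[OF asm Q])
  have f_co: "f (\<lambda>ijb\<in>I. co (K \<omega>) ijb) = logdet (Hmat M N K \<omega>) (1/\<sigma>2) Q" for K \<omega>
  proof -
    have "Hmat M N as (\<lambda>ijb\<in>I. co (K \<omega>) ijb) = Hmat M N K \<omega>"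
      by (intro eq_matI) (auto simp: Hmat_def as_def co_def I_def complex_eq_iff)
    then show ?thesis by (simp add: f_def)
  qed
  \<comment> \<open>Every real linear functional of the coordinates is the real part of a complex
    pairing, so the test families in \<open>cgauss\<close> cover all that is needed.\<close>
  have lin: "(\<Sum>ijb\<in>I. t ijb * co h ijb) = Re (\<Sum>i<M. \<Sum>j<N. cnj (as t i j) * h i j)" for t h
  proof -
    have "(\<Sum>ijb\<in>I. t ijb * co h ijb) = (\<Sum>i<M. \<Sum>j<N. \<Sum>b\<in>UNIV. t (i,j,b) * co h (i,j,b))"
      unfolding I_def sum.cartesian_product by (simp add: case_prod_beta)
    then show ?thesis by (simp add: UNIV_bool co_def as_def add.commute)
  qed
  define V where "V t i k = (\<Sum>j<N. t i j * W $$ (j,k))"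
    for t :: "nat \<Rightarrow> nat \<Rightarrow> complex" and i k
  have cnjW: "cnj (W $$ (j,k)) = W $$ (k,j)" if "j < N" "k < N" for j k
    using herm adj_index[of k W j] that W by simp
  have chH: "(LINT \<omega>|\<Omega>. cis (Re (\<Sum>i<M. \<Sum>j<N. cnj (t i j) * H \<omega> i j))) =
      complex_of_real (exp (- Re (\<Sum>i<M. \<Sum>j<N. \<Sum>l<M. \<Sum>m<N.
         cnj (t i j) * \<Sigma> $$ (i*N+j, l*N+m) * t l m) / 4))" for t
    using g by (simp add: cgauss_def)
  \<comment> \<open>The factor \<open>W\<close> passes from the random matrix to the test family,
    which becomes t W because \<open>W\<close> is Hermitian.\<close>
  have move: "(\<Sum>i<M. \<Sum>j<N. cnj (t i j) * H' \<omega> i j) = (\<Sum>i<M. \<Sum>k<N. cnj (V t i k) * H \<omega> i k)" for t \<omega>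
  proof (rule sum.cong[OF refl])
    fix i assume "i \<in> {..<M}"
    have "(\<Sum>j<N. cnj (t i j) * H' \<omega> i j) = (\<Sum>j<N. \<Sum>k<N. cnj (t i j) * W $$ (k,j) * H \<omega> i k)"
      by (simp add: H'_def sum_distrib_left mult_ac)
    also have "\<dots> = (\<Sum>k<N. \<Sum>j<N. cnj (t i j) * W $$ (k,j) * H \<omega> i k)" by (rule sum.swap)
    also have "\<dots> = (\<Sum>k<N. cnj (V t i k) * H \<omega> i k)"
      by (intro sum.cong refl) (simp add: V_def cnjW sum_distrib_right)
    finally show "(\<Sum>j<N. cnj (t i j) * H' \<omega> i j) = (\<Sum>k<N. cnj (V t i k) * H \<omega> i k)" .
  qed
  have quad: "(\<Sum>i<M. \<Sum>j<N. \<Sum>l<M. \<Sum>m<N. cnj (V t i j) * \<Sigma> $$ (i*N+j, l*N+m) * V t l m)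
      = (\<Sum>i<M. \<Sum>j<N. \<Sum>l<M. \<Sum>m<N. cnj (t i j) * \<Sigma> $$ (i*N+j, l*N+m) * t l m)" for t
  proof -
    have WW: "(\<Sum>k<N. W $$ (j,k) * W $$ (k,m)) = (if j = m then 1 else 0)" if "j < N" "m < N" for j m
      using mult_mat_index_sum[OF W W that] that by (simp add: invol)
    have block: "(\<Sum>j<N. \<Sum>m<N. cnj (V t i j) * \<Sigma> $$ (i*N+j, l*N+m) * V t l m)
        = (\<Sum>j<N. \<Sum>m<N. cnj (t i j) * \<Sigma> $$ (i*N+j, l*N+m) * t l m)"
      if "i \<in> {..<M}" "l \<in> {..<M}" for i l
    proof -
      have "cnj (V t i j) = (\<Sum>j'<N. cnj (t i j') * W $$ (j,j'))" if "j < N" for j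
        using that by (simp add: V_def cnjW)
      then have "(\<Sum>j<N. \<Sum>m<N. cnj (V t i j) * \<Sigma> $$ (i*N+j, l*N+m) * V t l m)
        = (\<Sum>j<N. \<Sum>m<N. (\<Sum>j'<N. cnj (t i j') * W $$ (j,j')) * \<Sigma> $$ (i*N+j, l*N+m)
            * (\<Sum>m'<N. t l m' * W $$ (m',m)))"
        unfolding V_def by (intro sum.cong refl) simp
      also have "\<dots> = (\<Sum>j<N. \<Sum>m<N. cnj (t i j) * \<Sigma> $$ (i*N+j, l*N+m) * t l m)"
        using that comm WW
        by (intro block_form_invariant[of N "\<lambda>j k. W $$ (j,k)" "\<lambda>j m. \<Sigma> $$ (i*N+j, l*N+m)"]) auto
      finally show ?thesis .
    qed
    have "(\<Sum>i<M. \<Sum>j<N. \<Sum>l<M. \<Sum>m<N. cnj (u i j) * \<Sigma> $$ (i*N+j, l*N+m) * u l m)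
        = (\<Sum>i<M. \<Sum>l<M. \<Sum>j<N. \<Sum>m<N. cnj (u i j) * \<Sigma> $$ (i*N+j, l*N+m) * u l m)" for u
      by (intro sum.cong refl sum.swap)
    then show ?thesis using block by (simp only:) (intro sum.cong refl block)
  qed
  have char: "(LINT \<omega>|\<Omega>. cis (\<Sum>ijb\<in>I. t ijb * co (H' \<omega>) ijb))
      = (LINT \<omega>|\<Omega>. cis (\<Sum>ijb\<in>I. t ijb * co (H \<omega>) ijb))" for t
    unfolding lin move chH quad ..
  have "(LINT \<omega>|\<Omega>. f (\<lambda>ijb\<in>I. co (H' \<omega>) ijb)) = (LINT \<omega>|\<Omega>. f (\<lambda>ijb\<in>I. co (H \<omega>) ijb))"
    by (rule char_eq_imp_integral_eq[OF _ com[OF H'm] com[OF Hm] char fm]) (auto simp: I_def)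
  then have "(LINT \<omega>|\<Omega>. logdet (Hmat M N H' \<omega>) (1/\<sigma>2) Q) = capacity \<Omega> M N H \<sigma>2 Q"
    by (simp only: f_co capacity_eq_logdet)
  moreover have "logdet (Hmat M N H' \<omega>) (1/\<sigma>2) Q = logdet (Hmat M N H \<omega>) (1/\<sigma>2) (W * Q * W)" for \<omega>
  proof -
    define h where "h = Hmat M N H \<omega>"
    have h: "h \<in> carrier_mat M N" by (simp add: h_def)
    have h': "Hmat M N H' \<omega> = h * W"
    proof (rule eq_matI)
      fix i j assume "i < dim_row (h * W)" "j < dim_col (h * W)"
      then have ij: "i < M" "j < N" using h W by auto
      show "Hmat M N H' \<omega> $$ (i,j) = (h * W) $$ (i,j)"
        unfolding mult_mat_index_sum[OF h W ij] using ij by (simp add: h_def H'_def)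
    qed (use h W carrier_matD[OF Hmat_carrier] in auto)
    have "h * W * Q * adj (h * W) = h * W * Q * (W * adj h)"
      by (simp add: adj_mult[OF h W] herm)
    also have "\<dots> = h * (W * Q * W) * adj h"
    proof -
      note c = h W Q adj_carrier[OF h]
      have "h * W * Q * (W * adj h) = (h * W * Q * W) * adj h"
        by (rule assoc_mult_mat[symmetric, of _ M N _ N _ M]) (use c in auto)
      also have "h * W * Q * W = h * (W * Q * W)"
        using c by (simp add: assoc_mult_mat[of _ M N _ N _ N] assoc_mult_mat[of _ N N _ N _ N])
      finally show ?thesis .
    qed
    finally show ?thesis using h unfolding h' logdet_def h_def[symmetric] by simp
  qed
  ultimately show ?thesis by (simp add: capacity_eq_logdet)
qed

section \<open>Reflections and the pinching by a projection\<close>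

lemma mtrace_eq_sum: "A \<in> carrier_mat n n \<Longrightarrow> mtrace A = (\<Sum>i<n. A $$ (i,i))"
  by (simp add: mtrace_def)

lemma mtrace_average:
  assumes "A \<in> carrier_mat n n" "B \<in> carrier_mat n n"
  shows "mtrace ((1/2) \<cdot>\<^sub>m (A + B)) = (mtrace A + mtrace B) / 2"
  using assms by (simp add: mtrace_def sum.distrib add_divide_distrib sum_divide_distrib)

lemma mtrace_mult_commute:
  assumes "A \<in> carrier_mat n m" "B \<in> carrier_mat m n"
  shows "mtrace (A * B) = mtrace (B * A)"
proof -
  have "mtrace (A * B) = (\<Sum>i<n. \<Sum>k<m. A $$ (i,k) * B $$ (k,i))"
    using assms by (simp add: mtrace_def scalar_prod_def atLeast0LessThan)
  also have "\<dots> = (\<Sum>k<m. \<Sum>i<n. A $$ (i,k) * B $$ (k,i))" by (rule sum.swap)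
  also have "\<dots> = mtrace (B * A)"
    using assms by (simp add: mtrace_def scalar_prod_def atLeast0LessThan mult.commute)
  finally show ?thesis .
qed

definition reflection :: "nat \<Rightarrow> complex mat \<Rightarrow> complex mat" where
  "reflection n P = 1\<^sub>m n - 2 \<cdot>\<^sub>m P"

text \<open>This is P Q P + (1 - P) Q (1 - P): conjugation by the reflection changes the sign of the
  two off-diagonal blocks, and the average removes them.\<close>

definition pinching :: "nat \<Rightarrow> complex mat \<Rightarrow> complex mat \<Rightarrow> complex mat" where
  "pinching n P Q = (1/2) \<cdot>\<^sub>m (Q + reflection n P * Q * reflection n P)"

context
  fixes n P
  assumes proj: "is_proj n P"
begin

lemma proj_carrier: "P \<in> carrier_mat n n" and proj_idem: "P * P = P" and proj_adj: "adj P = P"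
  using proj by (simp_all add: is_proj_def)

text \<open>The dimension is fixed here so that the simplifier can discharge the carrier conditions,
  in which the inner dimension of a product is not determined by the conclusion.\<close>

lemmas square_carrier = mult_carrier_mat[of _ n n _ n] add_carrier_mat[of _ n n]
  minus_carrier_mat[of _ n n] smult_carrier_mat[of _ n n]

lemmas square_algebra = mult_add_distrib_mat[of _ n n _ n] add_mult_distrib_mat[of _ n n _ _ n]
  mult_minus_distrib_mat[of _ n n _ n] minus_mult_distrib_mat[of _ n n _ _ n]
  mult_smult_distrib[of _ n n _ n] mult_smult_assoc_mat[of _ n n _ n]
  assoc_mult_mat[of _ n n _ n _ n]

text \<open>In products nested to the right, \<open>P * P\<close> does not occur as a subterm, so
  idempotence is needed in this form for rewriting.\<close>

lemma proj_absorb: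
  assumes "A \<in> carrier_mat n n"
  shows "P * (P * A) = P * A"
  using assoc_mult_mat[OF proj_carrier proj_carrier assms] by (simp add: proj_idem)

lemma reflection_carrier: "reflection n P \<in> carrier_mat n n"
  using proj_carrier by (simp add: reflection_def minus_carrier_mat)

lemma mult_reflection:
  assumes "A \<in> carrier_mat n n"
  shows "A * reflection n P = A - 2 \<cdot>\<^sub>m (A * P)" "reflection n P * A = A - 2 \<cdot>\<^sub>m (P * A)"
  unfolding reflection_def using assms proj_carrier
  by (simp_all add: square_algebra square_carrier)

lemma reflection_adj: "adj (reflection n P) = reflection n P"
proof (rule eq_matI)
  note d = carrier_matD[OF proj_carrier]
  fix i j assume "i < dim_row (reflection n P)" "j < dim_col (reflection n P)"
  then have ij: "i < n" "j < n" by (auto simp: reflection_def d)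
  have "cnj (P $$ (j,i)) = P $$ (i,j)"
    using adj_index[of i P j] ij d by (simp add: proj_adj)
  then show "adj (reflection n P) $$ (i,j) = reflection n P $$ (i,j)"
    using ij d by (simp add: reflection_def adj_def)
qed (simp_all add: adj_def reflection_def carrier_matD[OF proj_carrier])

lemma reflection_involution: "reflection n P * reflection n P = 1\<^sub>m n"
proof -
  have "reflection n P * reflection n P = reflection n P - 2 \<cdot>\<^sub>m (P - 2 \<cdot>\<^sub>m P)"
    by (simp add: mult_reflection(2)[OF reflection_carrier] mult_reflection(1)[OF proj_carrier] proj_idem)
  also have "\<dots> = 1\<^sub>m n"
    by (intro eq_matI) (auto simp: reflection_def carrier_matD[OF proj_carrier])
  finally show ?thesis .
qed

lemma pinching_expand:
  assumes Q: "Q \<in> carrier_mat n n"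
  shows "pinching n P Q = Q - Q * P - P * Q + 2 \<cdot>\<^sub>m (P * (Q * P))"
proof -
  have "reflection n P * Q * reflection n P
      = Q - 2 \<cdot>\<^sub>m (P * Q) - 2 \<cdot>\<^sub>m (Q * P - 2 \<cdot>\<^sub>m (P * (Q * P)))"
    unfolding mult_reflection(2)[OF Q] using Q proj_carrier
    by (simp add: mult_reflection(1) square_algebra square_carrier)
  then show ?thesis
    unfolding pinching_def using Q proj_carrier
    by (intro eq_matI) (auto simp: field_simps simp del: index_mult_mat(1))
qed

lemma pinching_commutes:
  assumes Q: "Q \<in> carrier_mat n n"
  shows "pinching n P Q * P = P * pinching n P Q"
proof -
  \<comment> \<open>Both products equal P Q P; the cancelling terms are kept so that the two
    expansions can be compared entrywise.\<close>
  have "pinching n P Q * P = Q * P - Q * P - P * (Q * P) + 2 \<cdot>\<^sub>m (P * (Q * P))"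
    unfolding pinching_expand[OF Q] using Q proj_carrier
    by (simp add: square_algebra square_carrier proj_idem)
  also have "\<dots> = P * Q - P * (Q * P) - P * Q + 2 \<cdot>\<^sub>m (P * (Q * P))"
    using Q proj_carrier by (intro eq_matI) (auto simp del: index_mult_mat(1))
  also have "\<dots> = P * pinching n P Q"
    unfolding pinching_expand[OF Q] using Q proj_carrier
    by (simp add: square_algebra square_carrier proj_absorb)
  finally show ?thesis .
qed

text \<open>Every term of the expansion that contains \<open>P\<close> is annihilated by
  \<open>R\<close>, from either side: P Q R = P R Q = 0 and R Q P = Q R P = 0. What survives is Q R
  and R Q. This is what allows one pinching after another.\<close>

lemma pinching_preserves_commuting:
  assumes Q: "Q \<in> carrier_mat n n" and R: "R \<in> carrier_mat n n"
    and RP: "R * P = 0\<^sub>m n n" "P * R = 0\<^sub>m n n" and comm: "Q * R = R * Q"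
  shows "pinching n P Q * R = R * pinching n P Q"
proof -
  have PQR: "P * (Q * R) = 0\<^sub>m n n"
    using assoc_mult_mat[OF proj_carrier R Q] Q by (simp add: comm RP)
  have RPX: "R * (P * X) = 0\<^sub>m n n" if "X \<in> carrier_mat n n" for X
    using assoc_mult_mat[OF R proj_carrier that] that by (simp add: RP)
  have RQP: "R * (Q * P) = 0\<^sub>m n n"
    using assoc_mult_mat[OF R Q proj_carrier] assoc_mult_mat[OF Q R proj_carrier] Q
    by (simp add: comm[symmetric] RP)
  have z: "Q * 0\<^sub>m n n = 0\<^sub>m n n" "P * 0\<^sub>m n n = 0\<^sub>m n n" using Q proj_carrier by auto
  have "pinching n P Q * R = Q * R - 0\<^sub>m n n - 0\<^sub>m n n + 2 \<cdot>\<^sub>m 0\<^sub>m n n"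
    unfolding pinching_expand[OF Q] using Q R proj_carrier
    by (simp add: square_algebra square_carrier PQR RP z)
  moreover have "R * pinching n P Q = R * Q - 0\<^sub>m n n - 0\<^sub>m n n + 2 \<cdot>\<^sub>m 0\<^sub>m n n"
    unfolding pinching_expand[OF Q] using Q R proj_carrier
    by (simp add: square_algebra square_carrier RQP RPX)
  ultimately show ?thesis by (simp only: comm)
qed

lemma psd_reflection_congruence: "psd n Q \<Longrightarrow> psd n (reflection n P * Q * reflection n P)"
  using psd_congruence[OF reflection_carrier] by (simp add: reflection_adj)

lemma psd_pinching: "psd n Q \<Longrightarrow> psd n (pinching n P Q)"
  using psd_smult[OF psd_add[OF _ psd_reflection_congruence], of Q Q "1/2"] by (simp add: pinching_def)

lemma mtrace_pinching:
  assumes Q: "Q \<in> carrier_mat n n"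
  shows "mtrace (pinching n P Q) = mtrace Q"
proof -
  let ?W = "reflection n P"
  note W = reflection_carrier
  have WQW: "?W * Q * ?W \<in> carrier_mat n n" using Q W by (simp add: square_carrier)
  have "mtrace (?W * Q * ?W) = mtrace (?W * (?W * Q))"
    using mtrace_mult_commute[OF mult_carrier_mat[OF W Q] W] .
  also have "?W * (?W * Q) = Q"
    using assoc_mult_mat[OF W W Q] Q by (simp add: reflection_involution)
  finally have "mtrace (?W * Q * ?W) = mtrace Q" .
  then show ?thesis unfolding pinching_def by (simp add: mtrace_average[OF Q WQW])
qed

text \<open>With P = A^t for \<open>A\<close> in the commutant, the transpose of the reflection is 1
  - 2 A, which commutes with every block of the covariance. The two matrices that are averaged
  therefore have equal capacity, and concavity favours the average.\<close>

lemma capacity_pinching: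
  assumes g: "cgauss \<Omega> M n H \<Sigma>" and P: "P \<in> transpose_mat ` right_commutant M n \<Sigma>"
    and Q: "psd n Q" and "\<sigma>2 > 0"
  shows "capacity \<Omega> M n H \<sigma>2 Q \<le> capacity \<Omega> M n H \<sigma>2 (pinching n P Q)"
proof -
  let ?W = "reflection n P"
  obtain A where A: "A \<in> right_commutant M n \<Sigma>" "P = transpose_mat A" using P by auto
  have Ac: "A \<in> carrier_mat n n" using A by (simp add: right_commutant_def)
  have S: "\<Sigma> \<in> carrier_mat (M*n) (M*n)" using g by (simp add: cgauss_def)
  have "capacity \<Omega> M n H \<sigma>2 (?W * Q * ?W) = capacity \<Omega> M n H \<sigma>2 Q"
  proof (rule capacity_congruence_invariant[OF g reflection_carrier reflection_adj reflection_involution])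
    fix i l j m assume *: "i < M" "l < M" "j < n" "m < n"
    have W: "?W $$ (x,y) = (if x = y then 1 else 0) - 2 * A $$ (y,x)" if "x < n" "y < n" for x y
      using that Ac by (simp add: reflection_def A(2))
    have "(\<Sum>k<n. ?W $$ (k,j) * \<Sigma> $$ (i*n+k, l*n+m))
        = (\<Sum>k<n. (if k = j then \<Sigma> $$ (i*n+j, l*n+m) else 0) - 2 * (A $$ (j,k) * \<Sigma> $$ (i*n+k, l*n+m)))"
      using * by (intro sum.cong refl) (auto simp: W algebra_simps)
    also have "\<dots> = \<Sigma> $$ (i*n+j, l*n+m) - 2 * (\<Sum>k<n. A $$ (j,k) * \<Sigma> $$ (i*n+k, l*n+m))"
      using * by (simp add: sum_subtractf sum_distrib_left)
    also have "\<dots> = \<Sigma> $$ (i*n+j, l*n+m) - 2 * (\<Sum>k<n. \<Sigma> $$ (i*n+j, l*n+k) * A $$ (k,m))"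
      using * by (simp add: right_commutant_block[OF A(1) S])
    also have "\<dots> = (\<Sum>k<n. (if k = m then \<Sigma> $$ (i*n+j, l*n+m) else 0) - 2 * (\<Sigma> $$ (i*n+j, l*n+k) * A $$ (k,m)))"
      using * by (simp add: sum_subtractf sum_distrib_left)
    also have "\<dots> = (\<Sum>k<n. \<Sigma> $$ (i*n+j, l*n+k) * ?W $$ (m,k))"
      using * by (intro sum.cong refl) (auto simp: W algebra_simps)
    finally show "(\<Sum>k<n. ?W $$ (k,j) * \<Sigma> $$ (i*n+k, l*n+m)) = (\<Sum>k<n. \<Sigma> $$ (i*n+j, l*n+k) * ?W $$ (m,k))" .
  qed (use Q in \<open>simp_all add: psd_def\<close>)
  then show ?thesis
    using capacity_midpoint[OF g Q psd_reflection_congruence[OF Q] \<open>\<sigma>2 > 0\<close>]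
    by (simp add: pinching_def)
qed

end

text \<open>The entry is the inner product of u_k with Q u_l, for columns u_k in the range of
  \<open>R\<close> and u_l in that of \<open>S\<close>. Since \<open>R\<close> is self-adjoint and
  fixes u_k, it can be put in front of Q u_l, and R Q u_l = Q R S u_l = 0.\<close>

lemma block_entry_zero:
  assumes Q: "Q \<in> carrier_mat n n" and U: "U \<in> carrier_mat n n"
    and R: "is_proj n R" and S: "is_proj n S" and RS: "R * S = 0\<^sub>m n n" and comm: "Q * R = R * Q"
    and kl: "k < n" "l < n" and fix_k: "R *\<^sub>v col U k = col U k" and fix_l: "S *\<^sub>v col U l = col U l"
  shows "(adj U * Q * U) $$ (k,l) = 0"
proof -
  have Rc: "R \<in> carrier_mat n n" and Sc: "S \<in> carrier_mat n n" and Radj: "adj R = R"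
    using R S by (auto simp: is_proj_def)
  define u where "u = col U l"
  have u: "u \<in> carrier_vec n" using U kl by (simp add: u_def)
  have "R *\<^sub>v (Q *\<^sub>v u) = (R * Q) *\<^sub>v u" by (rule assoc_mult_mat_vec[OF Rc Q u, symmetric])
  also have "\<dots> = Q *\<^sub>v (R *\<^sub>v u)" unfolding comm[symmetric] by (rule assoc_mult_mat_vec[OF Q Rc u])
  also have "R *\<^sub>v u = R *\<^sub>v (S *\<^sub>v u)" using fix_l by (simp add: u_def)
  also have "\<dots> = (R * S) *\<^sub>v u" by (rule assoc_mult_mat_vec[OF Rc Sc u, symmetric])
  also have "\<dots> = 0\<^sub>v n" unfolding RS using u by (intro eq_vecI) auto
  also have "Q *\<^sub>v 0\<^sub>v n = 0\<^sub>v n" using Q by (intro eq_vecI) auto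
  finally have RQu: "R *\<^sub>v (Q *\<^sub>v u) = 0\<^sub>v n" .
  define q where "q = Q *\<^sub>v u"
  have q: "q \<in> carrier_vec n" using Q u by (simp add: q_def)
  have cnjR: "cnj (R $$ (i,j)) = R $$ (j,i)" if "i < n" "j < n" for i j
    using adj_index[of j R i] that Rc Radj by simp
  have Uk: "U $$ (i,k) = (\<Sum>j<n. R $$ (i,j) * U $$ (j,k))" if "i < n" for i
  proof -
    have "U $$ (i,k) = (R *\<^sub>v col U k) $ i" using fix_k U kl that by simp
    also have "\<dots> = (\<Sum>j<n. R $$ (i,j) * col U k $ j)"
      using U kl that by (intro mult_mat_vec_index_sum[OF Rc]) auto
    finally show ?thesis using U kl by simp
  qed
  have "(adj U * Q * U) $$ (k,l) = (\<Sum>i<n. cnj (U $$ (i,k)) * q $ i)"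
  proof -
    have "adj U * Q * U = adj U * (Q * U)"
      using U Q by (intro assoc_mult_mat[of _ n n _ n _ n]) auto
    then have "(adj U * Q * U) $$ (k,l) = (\<Sum>i<n. adj U $$ (k,i) * (Q * U) $$ (i,l))"
      using mult_mat_index_sum[OF adj_carrier[OF U] mult_carrier_mat[OF Q U] kl] by simp
    also have "\<dots> = (\<Sum>i<n. cnj (U $$ (i,k)) * q $ i)"
      using U Q kl by (intro sum.cong refl) (simp add: q_def u_def)
    finally show ?thesis .
  qed
  also have "\<dots> = (\<Sum>i<n. \<Sum>j<n. cnj (U $$ (j,k)) * (R $$ (j,i) * q $ i))"
  proof (intro sum.cong refl)
    fix i assume i: "i \<in> {..<n}"
    then have "cnj (U $$ (i,k)) = cnj (\<Sum>j<n. R $$ (i,j) * U $$ (j,k))"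
      by (intro arg_cong[where f = cnj] Uk) simp
    also have "\<dots> = (\<Sum>j<n. R $$ (j,i) * cnj (U $$ (j,k)))"
      unfolding cnj_sum complex_cnj_mult using i by (intro sum.cong refl) (simp add: cnjR)
    finally show "cnj (U $$ (i,k)) * q $ i = (\<Sum>j<n. cnj (U $$ (j,k)) * (R $$ (j,i) * q $ i))"
      by (simp only: sum_distrib_left mult_ac)
  qed
  also have "\<dots> = (\<Sum>j<n. \<Sum>i<n. cnj (U $$ (j,k)) * (R $$ (j,i) * q $ i))" by (rule sum.swap)
  also have "\<dots> = (\<Sum>j<n. cnj (U $$ (j,k)) * (R *\<^sub>v q) $ j)"
    by (intro sum.cong refl) (simp add: mult_mat_vec_index_sum[OF Rc q] sum_distrib_left del: index_mult_mat_vec)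
  also have "\<dots> = 0" using RQu by (simp add: q_def[symmetric])
  finally show ?thesis .
qed

theorem theorem2:
  fixes M N c :: nat and \<sigma>2 p :: real and \<Sigma> U :: "complex mat"
    and \<Omega> :: "'a measure" and H :: "'a \<Rightarrow> nat \<Rightarrow> nat \<Rightarrow> complex"
    and P :: "nat \<Rightarrow> complex mat" and d :: "nat \<Rightarrow> nat"
  assumes "M \<ge> 1" and "N \<ge> 1" and "\<sigma>2 > 0" and "p > 0"
    and "cgauss \<Omega> M N H \<Sigma>"
    and "separable M N \<Sigma>"
    and "right_commutant M N \<Sigma> \<noteq> {a \<cdot>\<^sub>m 1\<^sub>m N | a. True}"
    and "\<forall>j<c. minimal_proj (transpose_mat ` right_commutant M N \<Sigma>) N (P j)"
    and "\<forall>j<c. \<forall>k<c. j \<noteq> k \<longrightarrow> P j * P k = 0\<^sub>m N N"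
    and "msum N P c = 1\<^sub>m N"
    and "\<forall>j<c. mtrace (P j) = of_nat (d j)"
    and "U \<in> carrier_mat N N" and "adj U * U = 1\<^sub>m N"
    and "\<forall>j<c. \<forall>k. in_block d j k \<longrightarrow> P j *\<^sub>v col U k = col U k"
  shows "\<exists>Q. psd N Q \<and> Re (mtrace Q) \<le> p \<and>
           (\<forall>Q'. psd N Q' \<and> Re (mtrace Q') \<le> p \<longrightarrow>
                 capacity \<Omega> M N H \<sigma>2 Q' \<le> capacity \<Omega> M N H \<sigma>2 Q) \<and>
           (\<forall>j<c. \<forall>j'<c. \<forall>k l. j \<noteq> j' \<and> in_block d j k \<and> in_block d j' l \<longrightarrow>
                 (adj U * Q * U) $$ (k,l) = 0) \<and>
           (\<forall>j<c. Q * P j = P j * Q)"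
proof -
  note g = \<open>cgauss \<Omega> M N H \<Sigma>\<close>
  have proj: "is_proj N (P j)" "P j \<in> transpose_mat ` right_commutant M N \<Sigma>" "P j \<in> carrier_mat N N"
    if "j < c" for j
    using assms(8) that by (auto simp: minimal_proj_def is_proj_def)
  define optimal where "optimal Q \<longleftrightarrow> psd N Q \<and> Re (mtrace Q) \<le> p \<and>
    (\<forall>Q'. psd N Q' \<and> Re (mtrace Q') \<le> p \<longrightarrow> capacity \<Omega> M N H \<sigma>2 Q' \<le> capacity \<Omega> M N H \<sigma>2 Q)" for Q
  \<comment> \<open>Here \<open>b\<close> counts the projections already treated. Pinching by the
    next one keeps \<open>Q\<close> feasible without lowering the capacity, so it stays optimal, and
    orthogonality protects the commutation relations already obtained.\<close>
  have "\<exists>Q. optimal Q \<and> (\<forall>j<b. Q * P j = P j * Q)" if "b \<le> c" for b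
    using that
  proof (induction b)
    case 0
    then show ?case using capacity_attained[OF g \<open>\<sigma>2 > 0\<close>, of p] \<open>p > 0\<close> by (auto simp: optimal_def)
  next
    case (Suc b)
    then obtain Q where Q: "optimal Q" "\<forall>j<b. Q * P j = P j * Q" by auto
    have Qpsd: "psd N Q" and Qc: "Q \<in> carrier_mat N N" using Q(1) by (auto simp: optimal_def psd_def)
    have b: "b < c" using Suc.prems by simp
    let ?Q = "pinching N (P b) Q"
    have "optimal ?Q"
      using Q(1) psd_pinching[OF proj(1)[OF b] Qpsd] mtrace_pinching[OF proj(1)[OF b] Qc]
        capacity_pinching[OF proj(1)[OF b] g proj(2)[OF b] Qpsd \<open>\<sigma>2 > 0\<close>]
      unfolding optimal_def by (metis order_trans)
    moreover have "?Q * P j = P j * ?Q" if "j < Suc b" for j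
    proof (cases "j = b")
      case True
      then show ?thesis using pinching_commutes[OF proj(1)[OF b] Qc] by simp
    next
      case False
      then have j: "j < b" "j < c" using that b by auto
      have "P j * P b = 0\<^sub>m N N" "P b * P j = 0\<^sub>m N N"
        using assms(9) b j False by simp_all
      then show ?thesis
        using pinching_preserves_commuting[OF proj(1)[OF b] Qc proj(3)[OF j(2)]] Q(2) j(1) by blast
    qed
    ultimately show ?case by blast
  qed
  then obtain Q where Q: "optimal Q" "\<forall>j<c. Q * P j = P j * Q" by auto
  have Qc: "Q \<in> carrier_mat N N" using Q(1) by (auto simp: optimal_def psd_def)
  \<comment> \<open>The trace of the resolution of identity. It ensures that the indices of all
    blocks are below \<open>N\<close> and so denote actual columns of \<open>U\<close>.\<close>
  have sum_d: "(\<Sum>j<c. d j) = N"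
  proof -
    have "complex_of_nat (\<Sum>j<c. d j) = (\<Sum>j<c. mtrace (P j))"
      using assms(11) by simp
    also have "\<dots> = (\<Sum>j<c. \<Sum>i<N. P j $$ (i,i))"
      by (intro sum.cong refl mtrace_eq_sum proj(3)) simp
    also have "\<dots> = (\<Sum>i<N. \<Sum>j<c. P j $$ (i,i))" by (rule sum.swap)
    also have "\<dots> = (\<Sum>i<N. msum N P c $$ (i,i))" by (simp add: msum_def)
    also have "\<dots> = of_nat N" by (simp add: assms(10))
    finally show ?thesis by (simp only: of_nat_eq_iff)
  qed
  have in_block_less: "k < N" if "j < c" "in_block d j k" for j k
  proof -
    have "k < (\<Sum>i<Suc j. d i)" using that by (simp add: in_block_def)
    also have "\<dots> \<le> (\<Sum>i<c. d i)" using \<open>j < c\<close> by (intro sum_mono2) auto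
    finally show ?thesis by (simp add: sum_d)
  qed
  have "(adj U * Q * U) $$ (k,l) = 0"
    if "j < c" "j' < c" "j \<noteq> j'" "in_block d j k" "in_block d j' l" for j j' k l
    using that assms(9,12,14) Q(2) in_block_less
    by (intro block_entry_zero[OF Qc _ proj(1)[of j] proj(1)[of j']]) auto
  then show ?thesis using Q unfolding optimal_def by blast
qed

end
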